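(* Let $0<\alpha\le1$ and $C_0>0$, and let $\gamma>0$ be small enough. Given any $\varepsilon>0$ there exists $M>0$ depending on $C_0$ such that, for every $f:\mathbb{R}^2\to\mathbb{C}$ with $\|f\|_{C^{0,\alpha}(\mathbb{R}^2)}\le C_0$ and $\operatorname{supp}f\subset\{(x,y):y\ge x^2\}$, $$\|f(\cdot,\gamma)\|_2\lesssim M\,\frac{\left(\log\log\left(\|R[f]\|_{\varepsilon,\gamma}^{-1}\right)\right)^{\alpha}}{\left(\log\left(\|R[f]\|_{\varepsilon,\gamma}^{-1}\right)\right)^{\alpha}}$$ if $\|R[f]\|_{\varepsilon,\gamma}$ is sufficiently small. (The right-hand side is read as $0$ when $\|R[f]\|_{\varepsilon,\gamma}=0$.)
   Context: Hölder seminorm: $\|f\|_{C^{0,\alpha}(\mathbb{R}^2)}=\sup_{p\ne q}|f(p)-f(q)|/\|p-q\|^\alpha$. Radon transform: $R[f](\xi,\eta)=\int_{\mathbb{R}}f(x,\xi x+\eta)\,dx$. $\|\cdot\|_2$ is the norm of $L^2([-1,1])$. Data norm: $R_{\varepsilon,\gamma}=\{(\xi,\eta):|\xi|\le\varepsilon,|\eta|<\gamma\}$, and $\|\cdot\|_{\varepsilon,\gamma}$ is a fixed family of norms, increasing in $\varepsilon$ and $\gamma$, such that for some absolute constant $c>0$, $\|g\|_{\varepsilon,\gamma}\ge c\max\{\|g\|_{L^1(R_{\varepsilon,\gamma})},\|g(\cdot,\gamma)\|_{L^1[-\varepsilon,\varepsilon]}\}$; for example $\|g\|_{\varepsilon,\gamma}=\sup_{|\eta|\le\gamma}\|g(\cdot,\eta)\|_{L^1[-\varepsilon,\varepsilon]}$.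 $F\lesssim G$ means $F\le cG$ with an absolute constant $c>0$. "Small enough" for $\gamma$ means $0<\gamma\le\gamma_0$ for some absolute $\gamma_0>0$; "sufficiently small" for the data norm means below a positive threshold not depending on $f$. *)

theory Defs
  imports "HOL-Analysis.Analysis"
begin

definition hoelder_seminorm :: "real \<Rightarrow> (real \<times> real \<Rightarrow> complex) \<Rightarrow> ennreal" where
  "hoelder_seminorm \<alpha> f =
     (SUP (p, q) \<in> {(p, q). p \<noteq> q}. ennreal (norm (f p - f q) / dist p q powr \<alpha>))"

definition supp :: "(real \<times> real \<Rightarrow> complex) \<Rightarrow> (real \<times> real) set" where
  "supp f = closure {p. f p \<noteq> 0}"

definition radon :: "(real \<times> real \<Rightarrow> complex) \<Rightarrow> real \<times> real \<Rightarrow> complex" where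
  "radon f = (\<lambda>(\<xi>, \<eta>). LINT x|lborel. f (x, \<xi> * x + \<eta>))"

definition L2_norm :: "(real \<Rightarrow> complex) \<Rightarrow> real" where
  "L2_norm h = sqrt (LINT x:{-1..1}|lborel. (norm (h x))\<^sup>2)"

definition data_rect :: "real \<Rightarrow> real \<Rightarrow> (real \<times> real) set" where
  "data_rect \<epsilon> \<gamma> = {(\<xi>, \<eta>). \<bar>\<xi>\<bar> \<le> \<epsilon> \<and> \<bar>\<eta>\<bar> < \<gamma>}"

text \<open>
  Norms on complex functions on a set \<open>S\<close> are allowed to take the value \<open>\<infinity>\<close>, so that a norm that
  is finite only on some space of functions (for instance one involving derivatives) is covered:
  it is set to \<open>\<infinity>\<close> outside that space. Functions are total; the third clause makes the
  norm depend only on the values on \<open>S\<close>. The norm axioms are required on the functions that are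
  continuous on \<open>S\<close>, which is where the Radon transforms of continuous \<open>f\<close> with support in
  \<open>y \<ge> x\<^sup>2\<close> lie.
\<close>

definition extended_norm_on ::
    "(real \<times> real) set \<Rightarrow> ((real \<times> real \<Rightarrow> complex) \<Rightarrow> ennreal) \<Rightarrow> bool" where
  "extended_norm_on S n \<longleftrightarrow>
     (\<forall>g h. continuous_on S g \<longrightarrow> continuous_on S h \<longrightarrow> n (\<lambda>p. g p + h p) \<le> n g + n h) \<and>
     (\<forall>a g. continuous_on S g \<longrightarrow> n (\<lambda>p. a * g p) = ennreal (norm a) * n g) \<and>
     (\<forall>g. continuous_on S g \<longrightarrow> (n g = 0 \<longleftrightarrow> (\<forall>p\<in>S. g p = 0)))"

text \<open>
  The functions live on the closure of \<open>data_rect \<epsilon> \<gamma>\<close>, since the trace on the edge \<open>\<eta> = \<gamma>\<close> is used.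
  Only \<open>\<gamma> \<le> 1\<close> is considered: the slice of \<open>y \<ge> x\<^sup>2\<close> at height \<open>\<gamma>\<close> then lies in \<open>[-1, 1]\<close>, and the
  basic example \<open>sup {\<parallel>g(\<cdot>,\<eta>)\<parallel> | \<bar>\<eta>\<bar> \<le> \<gamma>}\<close> with the \<open>L\<^sup>1[-\<epsilon>, \<epsilon>]\<close> norm admits a constant \<open>c\<close> that is
  uniform in \<open>\<epsilon>\<close> and \<open>\<gamma>\<close> (namely \<open>1/2\<close>), which fails for unbounded \<open>\<gamma>\<close>.
\<close>

definition data_norm_family ::
    "real \<Rightarrow> (real \<Rightarrow> real \<Rightarrow> (real \<times> real \<Rightarrow> complex) \<Rightarrow> ennreal) \<Rightarrow> bool" where
  "data_norm_family c N \<longleftrightarrow>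
     (\<forall>\<epsilon> \<gamma>. 0 < \<epsilon> \<longrightarrow> 0 < \<gamma> \<longrightarrow> \<gamma> \<le> 1 \<longrightarrow>
        extended_norm_on (closure (data_rect \<epsilon> \<gamma>)) (N \<epsilon> \<gamma>)) \<and>
     (\<forall>\<epsilon> \<epsilon>' \<gamma> \<gamma>' g. 0 < \<epsilon> \<longrightarrow> \<epsilon> \<le> \<epsilon>' \<longrightarrow> 0 < \<gamma> \<longrightarrow> \<gamma> \<le> \<gamma>' \<longrightarrow> \<gamma>' \<le> 1 \<longrightarrow>
        continuous_on (closure (data_rect \<epsilon>' \<gamma>')) g \<longrightarrow> N \<epsilon> \<gamma> g \<le> N \<epsilon>' \<gamma>' g) \<and>
     (\<forall>\<epsilon> \<gamma> g. 0 < \<epsilon> \<longrightarrow> 0 < \<gamma> \<longrightarrow> \<gamma> \<le> 1 \<longrightarrow> continuous_on (closure (data_rect \<epsilon> \<gamma>)) g \<longrightarrow>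
        ennreal c * max (\<integral>\<^sup>+p\<in>data_rect \<epsilon> \<gamma>. ennreal (norm (g p)) \<partial>lborel)
                        (\<integral>\<^sup>+\<xi>\<in>{-\<epsilon>..\<epsilon>}. ennreal (norm (g (\<xi>, \<gamma>))) \<partial>lborel)
          \<le> N \<epsilon> \<gamma> g)"

definition log_rate :: "real \<Rightarrow> real \<Rightarrow> real" where
  "log_rate \<alpha> t =
     (if t = 0 then 0 else ln (ln (inverse t)) powr \<alpha> / ln (inverse t) powr \<alpha>)"

end

theory Submission
  imports Defs "HOL-Computational_Algebra.Polynomial" "HOL-Real_Asymp.Real_Asymp"
begin

text \<open>
  The derivatives in the slope \<open>\<xi>\<close> of the Radon transform reveal moments: formally
  \<open>(\<partial>/\<partial>\<xi>)\<^sup>k R[f](\<xi>, \<eta>) = (\<partial>/\<partial>\<eta>)\<^sup>k \<integral> x\<^sup>k f(x, \<xi> x + \<eta>) dx\<close>. Since \<open>f\<close> vanishes below the parabola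
  \<open>y = x\<^sup>2\<close>, the derivatives in \<open>\<eta>\<close> can be undone by integrating from below, and so the data on the
  rectangle determine all moments in \<open>x\<close> of \<open>f\<close> on lines close to \<open>y = \<gamma>\<close>. The proof makes this
  quantitative with a single scale \<open>h = 1 / n\<close>.

  First, \<open>f(x, \<gamma>)\<close> is replaced by its average \<open>A(x)\<close> over the points \<open>(x, \<gamma> + \<xi> x)\<close> with \<open>\<bar>\<xi>\<bar> \<le> h\<close>,
  against the weight \<open>(1 - (\<xi> / h)\<^sup>2)\<^sup>n\<close>. Hoelder continuity bounds the error by \<open>O(h\<^sup>\<alpha>)\<close>. Now no data
  have to be differentiated: \<open>k \<le> n\<close> integrations by parts in \<open>\<xi>\<close> replace \<open>x\<^sup>k\<close> by \<open>k\<close> derivatives of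
  the weight and \<open>k\<close> vertical primitives of \<open>f\<close> (\<open>moment_by_parts\<close>). Integrated in \<open>x\<close>, this bounds
  every polynomial moment of \<open>A\<close> of degree at most \<open>n\<close> by \<open>n\<^sup>O\<^sup>(\<^sup>n\<^sup>)\<close> times the data
  (\<open>polynomial_moment_le\<close>).

  Second, the values of \<open>A\<close> are recovered from these moments with the Jackson kernel, the fourth
  power of the Dirichlet kernel \<open>sin ((2 m + 1) \<theta>) / sin \<theta>\<close>. In the variable \<open>u = sin \<theta>\<close> it is a
  polynomial of degree \<open>8 m\<close> concentrated on \<open>\<bar>u\<bar> \<lesssim> 1 / m\<close>, so with \<open>n = 8 m\<close> the
  error is again \<open>O(h\<^sup>\<alpha>)\<close> (\<open>jackson_recovery\<close>).

  Together \<open>\<bar>f(x, \<gamma>)\<bar> \<lesssim> C n\<^sup>-\<^sup>\<alpha> + n\<^sup>6\<^sup>n t / c\<close> for all large \<open>n = 8 m\<close>, where \<open>t\<close> is the data norm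
  (\<open>slice_value_le\<close>). Choosing \<open>n\<close> of order \<open>log (1 / t) / log log (1 / t)\<close> gives the rate
  (\<open>scale_choice\<close>).
\<close>

section \<open>Coefficient norm of real polynomials\<close>

text \<open>
  This norm turns bounds on the moments
  \<open>\<integral> x\<^sup>k A(x) dx\<close> into a bound on \<open>\<integral> q(x) A(x) dx\<close>, and as it is submultiplicative it is easy to
  estimate for powers, compositions and derivatives.
\<close>

definition coeff_norm :: "real poly \<Rightarrow> real" where
  "coeff_norm p = (\<Sum>i\<le>degree p. \<bar>coeff p i\<bar>)"

lemma coeff_norm_bound:
  assumes "degree p \<le> n"
  shows "coeff_norm p = (\<Sum>i\<le>n. \<bar>coeff p i\<bar>)"
  unfolding coeff_norm_def
  by (rule sum.mono_neutral_left) (use assms in \<open>auto simp: coeff_eq_0\<close>)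

lemma coeff_norm_nonneg: "0 \<le> coeff_norm p"
  unfolding coeff_norm_def by (simp add: sum_nonneg)

lemma coeff_norm_0 [simp]: "coeff_norm 0 = 0"
  by (simp add: coeff_norm_def)

lemma coeff_norm_1 [simp]: "coeff_norm 1 = 1"
  by (simp add: coeff_norm_def)

lemma coeff_norm_add: "coeff_norm (p + q) \<le> coeff_norm p + coeff_norm q"
proof -
  define n where "n = max (degree p) (degree q)"
  have "coeff_norm (p + q) = (\<Sum>i\<le>n. \<bar>coeff p i + coeff q i\<bar>)"
    using coeff_norm_bound[of "p + q" n] by (simp add: n_def degree_add_le)
  also have "\<dots> \<le> (\<Sum>i\<le>n. \<bar>coeff p i\<bar>) + (\<Sum>i\<le>n. \<bar>coeff q i\<bar>)"
    by (simp add: sum.distrib[symmetric] sum_mono)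
  also have "\<dots> = coeff_norm p + coeff_norm q"
    using coeff_norm_bound[of p n] coeff_norm_bound[of q n] by (simp add: n_def)
  finally show ?thesis .
qed

lemma coeff_norm_smult: "coeff_norm (smult a p) = \<bar>a\<bar> * coeff_norm p"
  using coeff_norm_bound[of "smult a p" "degree p"]
  by (simp add: coeff_norm_def abs_mult sum_distrib_left degree_smult_le)

lemma coeff_norm_diff: "coeff_norm (p - q) \<le> coeff_norm p + coeff_norm q"
  using coeff_norm_add[of p "smult (-1) q"] coeff_norm_smult[of "-1" q] by simp

lemma coeff_norm_pCons [simp]: "coeff_norm (pCons a p) = \<bar>a\<bar> + coeff_norm p"
  using coeff_norm_bound[of "pCons a p" "Suc (degree p)"]
  by (simp add: coeff_norm_def degree_pCons_le sum.atMost_Suc_shift del: sum.atMost_Suc)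

lemma coeff_norm_mult: "coeff_norm (p * q) \<le> coeff_norm p * coeff_norm q"
proof (induction p)
  case (pCons a p)
  have "coeff_norm (pCons a p * q) \<le> \<bar>a\<bar> * coeff_norm q + coeff_norm (p * q)"
    using coeff_norm_add[of "smult a q" "pCons 0 (p * q)"] by (simp add: coeff_norm_smult)
  with pCons show ?case by (simp add: algebra_simps)
qed simp

lemma coeff_norm_power: "coeff_norm (p ^ n) \<le> coeff_norm p ^ n"
proof (induction n)
  case (Suc n)
  then show ?case
    using coeff_norm_mult[of p "p ^ n"] mult_left_mono[OF Suc coeff_norm_nonneg[of p]] by simp
qed simp

lemma coeff_norm_pcompose:
  assumes "coeff_norm q \<le> 1"
  shows "coeff_norm (pcompose p q) \<le> coeff_norm p"
proof (induction p)
  case (pCons a p)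
  have "coeff_norm (pcompose (pCons a p) q) \<le> \<bar>a\<bar> + coeff_norm (q * pcompose p q)"
    using coeff_norm_add[of "[:a:]" "q * pcompose p q"] by (simp add: pcompose_pCons)
  also have "coeff_norm (q * pcompose p q) \<le> 1 * coeff_norm (pcompose p q)"
    using coeff_norm_mult[of q "pcompose p q"] mult_right_mono[OF assms coeff_norm_nonneg]
    by (rule order_trans)
  finally show ?case using pCons by simp
qed simp

lemma coeff_norm_pderiv: "coeff_norm (pderiv p) \<le> real (degree p) * coeff_norm p"
proof (cases "degree p")
  case 0
  then have "pderiv p = 0" by (simp add: pderiv_eq_0_iff)
  then show ?thesis by (simp add: coeff_norm_nonneg)
next
  case (Suc d)
  have "coeff_norm (pderiv p) = (\<Sum>i\<le>d. \<bar>of_nat (Suc i) * coeff p (Suc i)\<bar>)"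
    using coeff_norm_bound[of "pderiv p" d] Suc by (simp add: degree_pderiv coeff_pderiv)
  also have "\<dots> \<le> (\<Sum>i\<le>d. real (degree p) * \<bar>coeff p (Suc i)\<bar>)"
    using Suc by (intro sum_mono) (auto simp: abs_mult intro!: mult_right_mono)
  also have "\<dots> \<le> real (degree p) * coeff_norm p"
    unfolding coeff_norm_def Suc sum.atMost_Suc_shift by (simp add: sum_distrib_left algebra_simps)
  finally show ?thesis .
qed

lemma coeff_norm_higher_pderiv:
  "coeff_norm ((pderiv ^^ k) p) \<le> real (degree p) ^ k * coeff_norm p"
proof (induction k)
  case (Suc k)
  have deg: "degree ((pderiv ^^ k) p) \<le> degree p"
    by (induction k) (auto simp: degree_pderiv)
  have "coeff_norm ((pderiv ^^ Suc k) p)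
      \<le> real (degree ((pderiv ^^ k) p)) * coeff_norm ((pderiv ^^ k) p)"
    using coeff_norm_pderiv by simp
  also have "\<dots> \<le> real (degree p) * (real (degree p) ^ k * coeff_norm p)"
    using deg Suc by (intro mult_mono) (auto simp: coeff_norm_nonneg)
  finally show ?case by (simp add: mult.assoc)
qed simp

lemma abs_poly_le_coeff_norm:
  assumes "\<bar>x\<bar> \<le> 1"
  shows "\<bar>poly p x\<bar> \<le> coeff_norm p"
proof -
  have "\<bar>poly p x\<bar> \<le> (\<Sum>i\<le>degree p. \<bar>coeff p i * x ^ i\<bar>)"
    by (simp add: poly_altdef sum_abs)
  also have "\<dots> \<le> coeff_norm p"
    unfolding coeff_norm_def using assms
    by (intro sum_mono) (auto simp: abs_mult power_abs power_le_one intro!: mult_left_le)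
  finally show ?thesis .
qed

section \<open>The algebraic Jackson kernel\<close>

text \<open>
  These are, up to sign, the Chebyshev polynomials \<open>T\<^sub>2\<^sub>k\<close>, arranged so that the substitution
  \<open>u = sin \<theta>\<close> gives \<open>cos (2 k \<theta>)\<close>. The sine puts the point where the kernels below peak at \<open>u = 0\<close>.
\<close>

fun cheb :: "nat \<Rightarrow> real poly" where
  "cheb 0 = 1"
| "cheb (Suc 0) = [:1, 0, -2:]"
| "cheb (Suc (Suc k)) = [:2, 0, -4:] * cheb (Suc k) - cheb k"

lemma poly_cheb_sin: "poly (cheb k) (sin \<theta>) = cos (2 * real k * \<theta>)"
proof (induction k rule: cheb.induct)
  case 2
  then show ?case by (simp add: cos_double_sin power2_eq_square)
next
  case (3 k)
  have sum: "cos (2 * real (Suc (Suc k)) * \<theta>) + cos (2 * real k * \<theta>)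
      = 2 * cos (2 * real (Suc k) * \<theta>) * cos (2 * \<theta>)"
    using cos_add[of "2 * real (Suc k) * \<theta>" "2 * \<theta>"]
      cos_diff[of "2 * real (Suc k) * \<theta>" "2 * \<theta>"]
    by (simp add: algebra_simps)
  have double: "cos (2 * \<theta>) = 1 - 2 * (sin \<theta>)\<^sup>2"
    by (simp add: cos_double_sin)
  have "cos (2 * real (Suc (Suc k)) * \<theta>)
      = (2 - 4 * (sin \<theta>)\<^sup>2) * cos (2 * real (Suc k) * \<theta>) - cos (2 * real k * \<theta>)"
    using sum unfolding double by (simp add: algebra_simps)
  moreover have "poly (cheb (Suc (Suc k))) (sin \<theta>)
      = (2 - 4 * (sin \<theta>)\<^sup>2) * poly (cheb (Suc k)) (sin \<theta>) - poly (cheb k) (sin \<theta>)"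
    by (simp add: algebra_simps power2_eq_square)
  ultimately show ?case using 3 by metis
qed simp

lemma degree_cheb: "degree (cheb k) \<le> 2 * k"
proof (induction k rule: cheb.induct)
  case (3 k)
  then show ?case
    by (auto simp del: mult_pCons_left intro!: degree_diff_le order_trans[OF degree_mult_le])
qed auto

lemma coeff_norm_cheb: "coeff_norm (cheb k) \<le> 7 ^ k"
proof (induction k rule: cheb.induct)
  case (3 k)
  have "coeff_norm (cheb (Suc (Suc k))) \<le> 6 * coeff_norm (cheb (Suc k)) + coeff_norm (cheb k)"
    using coeff_norm_diff[of "[:2, 0, -4:] * cheb (Suc k)" "cheb k"]
      coeff_norm_mult[of "[:2, 0, -4:]" "cheb (Suc k)"] by simp
  moreover have "(0::real) \<le> 7 ^ k" by simp
  ultimately show ?case using 3 unfolding power_Suc by linarith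
qed auto

text \<open>
  The Dirichlet kernel \<open>1 + 2 cos 2\<theta> + \<dots> + 2 cos 2m\<theta> = sin ((2 m + 1) \<theta>) / sin \<theta>\<close> in the variable
  \<open>u = sin \<theta>\<close>: it is an algebraic polynomial in \<open>u\<close>, with height \<open>2 m + 1\<close> at \<open>0\<close> and bounded by
  \<open>1 / \<bar>u\<bar>\<close> away from it.
\<close>

definition dirichlet :: "nat \<Rightarrow> real poly" where
  "dirichlet m = 1 + smult 2 (\<Sum>k<m. cheb (Suc k))"

lemma dirichlet_Suc: "dirichlet (Suc m) = dirichlet m + smult 2 (cheb (Suc m))"
  by (simp add: dirichlet_def smult_add_right)

lemma degree_dirichlet: "degree (dirichlet m) \<le> 2 * m"
  unfolding dirichlet_def
  by (auto intro!: degree_add_le order_trans[OF degree_smult_le] degree_sum_le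
        order_trans[OF degree_cheb])

lemma coeff_norm_dirichlet: "coeff_norm (dirichlet m) \<le> 3 * 7 ^ m"
proof (induction m)
  case (Suc m)
  have "coeff_norm (dirichlet (Suc m)) \<le> coeff_norm (dirichlet m) + 2 * coeff_norm (cheb (Suc m))"
    using coeff_norm_add[of "dirichlet m" "smult 2 (cheb (Suc m))"]
    by (simp add: dirichlet_Suc coeff_norm_smult)
  moreover have "(0::real) \<le> 7 ^ m" by simp
  ultimately show ?case
    using coeff_norm_cheb[of "Suc m"] Suc unfolding power_Suc by linarith
qed (simp add: dirichlet_def)

lemma sin_mult_dirichlet: "sin \<theta> * poly (dirichlet m) (sin \<theta>) = sin (real (2 * m + 1) * \<theta>)"
proof (induction m)
  case (Suc m)
  have "sin (real (2 * Suc m + 1) * \<theta>) - sin (real (2 * m + 1) * \<theta>)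
      = 2 * sin \<theta> * cos (2 * real (Suc m) * \<theta>)"
    using sin_add[of "2 * real (Suc m) * \<theta>" \<theta>] sin_diff[of "2 * real (Suc m) * \<theta>" \<theta>]
    by (simp add: algebra_simps)
  then show ?case
    using Suc by (simp add: dirichlet_Suc poly_cheb_sin algebra_simps del: cheb.simps)
qed (simp add: dirichlet_def)

lemma abs_sin_mult_le: "\<bar>sin (real k * \<theta>)\<bar> \<le> real k * \<bar>sin \<theta>\<bar>"
proof (induction k)
  case (Suc k)
  have "\<bar>sin (real (Suc k) * \<theta>)\<bar> \<le> \<bar>sin (real k * \<theta>)\<bar> * \<bar>cos \<theta>\<bar> + \<bar>cos (real k * \<theta>)\<bar> * \<bar>sin \<theta>\<bar>"
    using sin_add[of "real k * \<theta>" \<theta>]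
      abs_triangle_ineq[of "sin (real k * \<theta>) * cos \<theta>" "cos (real k * \<theta>) * sin \<theta>"]
    by (simp add: algebra_simps abs_mult)
  also have "\<dots> \<le> \<bar>sin (real k * \<theta>)\<bar> * 1 + 1 * \<bar>sin \<theta>\<bar>"
    by (intro add_mono mult_mono) auto
  finally show ?case using Suc by (simp add: algebra_simps)
qed simp

context
  fixes u :: real
  assumes u: "\<bar>u\<bar> \<le> 1"
begin

lemma cheb_bounds:
  "\<bar>poly (cheb k) u\<bar> \<le> 1" "1 - 2 * (real k)\<^sup>2 * u\<^sup>2 \<le> poly (cheb k) u"
proof -
  define \<theta> where "\<theta> = arcsin u"
  have su: "sin \<theta> = u" unfolding \<theta>_def by (rule sin_arcsin) (use u in auto)
  have eq: "poly (cheb k) u = cos (2 * (real k * \<theta>))"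
    using poly_cheb_sin[of k \<theta>] su by (simp add: mult.assoc)
  show "\<bar>poly (cheb k) u\<bar> \<le> 1" using eq by simp
  have "(sin (real k * \<theta>))\<^sup>2 \<le> (real k * \<bar>u\<bar>)\<^sup>2"
    using power_mono[OF abs_sin_mult_le[of k \<theta>], of 2] su by simp
  then show "1 - 2 * (real k)\<^sup>2 * u\<^sup>2 \<le> poly (cheb k) u"
    unfolding eq cos_double_sin by (simp add: power_mult_distrib)
qed

lemma abs_dirichlet_le: "\<bar>poly (dirichlet m) u\<bar> \<le> 2 * real m + 1"
proof (induction m)
  case (Suc m)
  then show ?case
    using cheb_bounds(1)[of "Suc m"] by (simp add: dirichlet_Suc del: cheb.simps)
qed (simp add: dirichlet_def)

lemma abs_mult_dirichlet_le: "\<bar>u * poly (dirichlet m) u\<bar> \<le> 1"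
proof -
  have su: "sin (arcsin u) = u" by (rule sin_arcsin) (use u in auto)
  show ?thesis
    using sin_mult_dirichlet[of "arcsin u" m] unfolding su by simp
qed

text \<open>
  Each summand satisfies \<open>cos (2 k \<theta>) = 1 - 2 sin\<^sup>2 (k \<theta>) \<ge> 1 - 2 k\<^sup>2 u\<^sup>2\<close>, so within distance
  \<open>1 / (2 m + 1)\<close> of the peak every cosine is still at least \<open>1/2\<close>.
\<close>

lemma dirichlet_ge:
  assumes "(2 * real m + 1) * \<bar>u\<bar> \<le> 1"
  shows "(2 * real m + 1) / 2 \<le> poly (dirichlet m) u"
proof -
  have "real m * \<bar>u\<bar> \<le> 1 / 2"
    using assms abs_ge_zero[of u] by (simp add: algebra_simps)
  from power_mono[OF this, of 2] have mu: "2 * (real m)\<^sup>2 * u\<^sup>2 \<le> 1 / 2"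
    by (simp add: power_mult_distrib power_divide)
  have "1 + real j \<le> poly (dirichlet j) u" if "j \<le> m" for j
    using that
  proof (induction j)
    case (Suc j)
    have "(real (Suc j))\<^sup>2 \<le> (real m)\<^sup>2"
      using Suc.prems by (intro power_mono) auto
    then have "2 * (real (Suc j))\<^sup>2 * u\<^sup>2 \<le> 2 * (real m)\<^sup>2 * u\<^sup>2"
      by (intro mult_right_mono) auto
    with cheb_bounds(2)[of "Suc j"] mu have "1 / 2 \<le> poly (cheb (Suc j)) u"
      by linarith
    then show ?case using Suc by (simp add: dirichlet_Suc del: cheb.simps)
  qed (simp add: dirichlet_def)
  from this[of m] show ?thesis by simp
qed

end

text \<open>
  The Jackson kernel in algebraic form. The fourth power makes the kernel decay like \<open>u\<^sup>-\<^sup>4\<close>, so that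
  its second moment is as small as the width \<open>1 / m\<close> of its peak suggests. A polynomial kernel of
  degree \<open>n\<close> whose width is only \<open>1 / \<surd>n\<close>, as in the proofs of Bernstein and Landau, would halve the
  exponent in the final rate.
\<close>

definition jackson :: "nat \<Rightarrow> real poly" where
  "jackson m = dirichlet m ^ 4"

lemma degree_jackson: "degree (jackson m) \<le> 8 * m"
  unfolding jackson_def
  using degree_power_le[of "dirichlet m" 4] degree_dirichlet[of m] by simp

lemma coeff_norm_jackson: "coeff_norm (jackson m) \<le> 81 * 7 ^ (4 * m)"
proof -
  have "coeff_norm (jackson m) \<le> (3 * 7 ^ m) ^ 4"
    unfolding jackson_def
    by (rule order_trans[OF coeff_norm_power])
       (rule power_mono[OF coeff_norm_dirichlet coeff_norm_nonneg])
  then show ?thesis by (simp add: power_mult_distrib power_mult[symmetric] mult.commute)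
qed

lemma jackson_nonneg: "0 \<le> poly (jackson m) u"
  by (simp add: jackson_def poly_power)

lemma jackson_mass: "1 / 8 * (2 * real m + 1) ^ 3 \<le> integral {-1..1} (poly (jackson m))"
proof -
  define M where "M = 2 * real m + 1"
  have M: "1 \<le> M" by (simp add: M_def)
  have "1 / 8 * M ^ 3 = integral {- (1 / M)..1 / M} (\<lambda>u. M ^ 4 / 16)"
    using M by (simp add: field_simps power_def eval_nat_numeral)
  also have "\<dots> \<le> integral {- (1 / M)..1 / M} (poly (jackson m))"
  proof (rule integral_le)
    fix u assume "u \<in> {- (1 / M)..1 / M}"
    then have "\<bar>u\<bar> \<le> 1 / M" by auto
    then have Mu: "M * \<bar>u\<bar> \<le> 1" using M by (simp add: field_simps)
    moreover have "\<bar>u\<bar> \<le> 1" using \<open>\<bar>u\<bar> \<le> 1 / M\<close> M by (auto simp: divide_le_eq elim!: order_trans)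
    ultimately have "M / 2 \<le> poly (dirichlet m) u"
      using dirichlet_ge[of u m] by (simp add: M_def)
    from power_mono[OF this, of 4] M show "M ^ 4 / 16 \<le> poly (jackson m) u"
      by (simp add: jackson_def poly_power power_divide)
  qed (auto intro!: integrable_continuous_real continuous_intros)
  also have "\<dots> \<le> integral {-1..1} (poly (jackson m))"
    using M by (intro integral_subset_le)
      (auto intro!: integrable_continuous_real continuous_intros jackson_nonneg simp: field_simps)
  finally show ?thesis by (simp add: M_def)
qed

text \<open>
  Since \<open>\<bar>D(u)\<bar> \<le> M\<close> and \<open>\<bar>u D(u)\<bar> \<le> 1\<close> for \<open>M = 2 m + 1\<close>, adding the squares of these bounds gives
  \<open>u\<^sup>2 D(u)\<^sup>4 \<le> D(u)\<^sup>2 \<le> 2 M\<^sup>2 / (1 + M\<^sup>2 u\<^sup>2)\<close>, which integrates to \<open>O(M)\<close>, whereas the mass of the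
  kernel is of order \<open>M\<^sup>3\<close>.
\<close>

lemma jackson_second_moment:
  "integral {-1..1} (\<lambda>u. u\<^sup>2 * poly (jackson m) u)
    \<le> 64 / (2 * real m + 1)\<^sup>2 * integral {-1..1} (poly (jackson m))"
proof -
  define M where "M = 2 * real m + 1"
  have M: "1 \<le> M" by (simp add: M_def)
  have pos: "0 < 1 + (M * u)\<^sup>2" for u by (simp add: add_pos_nonneg)
  have "((\<lambda>u. 2 * M\<^sup>2 / (1 + (M * u)\<^sup>2)) has_integral
      (2 * M * arctan (M * 1) - 2 * M * arctan (M * -1))) {-1..1}"
    by (rule fundamental_theorem_of_calculus)
       (auto intro!: derivative_eq_intros
         simp: has_real_derivative_iff_has_vector_derivative[symmetric] power2_eq_square field_simps)
  then have I: "((\<lambda>u. 2 * M\<^sup>2 / (1 + (M * u)\<^sup>2)) has_integral 4 * M * arctan M) {-1..1}"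
    by (simp add: arctan_minus algebra_simps)
  have "integral {-1..1} (\<lambda>u. u\<^sup>2 * poly (jackson m) u)
      \<le> integral {-1..1} (\<lambda>u. 2 * M\<^sup>2 / (1 + (M * u)\<^sup>2))"
  proof (rule integral_le)
    fix u :: real assume "u \<in> {-1..1}"
    then have u: "\<bar>u\<bar> \<le> 1" by auto
    define d where "d = poly (dirichlet m) u"
    have d: "\<bar>d\<bar> \<le> M" "\<bar>u * d\<bar> \<le> 1"
      using abs_dirichlet_le[OF u, of m] abs_mult_dirichlet_le[OF u, of m]
      by (auto simp: d_def M_def)
    have d2: "d\<^sup>2 \<le> M\<^sup>2" using power_mono[OF d(1), of 2] by simp
    have ud2: "(u * d)\<^sup>2 \<le> 1" using power_mono[OF d(2), of 2] by simp
    have "d\<^sup>2 * (1 + (M * u)\<^sup>2) = d\<^sup>2 + M\<^sup>2 * (u * d)\<^sup>2"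
      by (simp add: algebra_simps power_mult_distrib)
    also have "\<dots> \<le> M\<^sup>2 + M\<^sup>2 * 1"
      by (rule add_mono[OF d2 mult_left_mono[OF ud2]]) simp
    finally have "d\<^sup>2 \<le> 2 * M\<^sup>2 / (1 + (M * u)\<^sup>2)"
      using pos[of u] by (simp add: le_divide_eq)
    moreover have "u\<^sup>2 * poly (jackson m) u \<le> d\<^sup>2"
      using mult_right_mono[OF ud2, of "d\<^sup>2"]
      by (simp add: jackson_def poly_power d_def power_mult_distrib power2_eq_square
          power_def eval_nat_numeral algebra_simps)
    ultimately show "u\<^sup>2 * poly (jackson m) u \<le> 2 * M\<^sup>2 / (1 + (M * u)\<^sup>2)" by linarith
  qed (use I pos in \<open>auto intro!: integrable_continuous_real continuous_intros
         simp: less_imp_neq[symmetric] has_integral_integrable\<close>)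
  also have "\<dots> = 4 * M * arctan M" using I by (rule integral_unique)
  also have "\<dots> \<le> 4 * M * 2"
    using arctan_ubound[of M] pi_half_less_two M by (intro mult_left_mono) auto
  also have "\<dots> = 64 / M\<^sup>2 * (1 / 8 * M ^ 3)"
    using M by (simp add: field_simps power_def eval_nat_numeral)
  also have "\<dots> \<le> 64 / M\<^sup>2 * integral {-1..1} (poly (jackson m))"
    using jackson_mass[of m] M by (intro mult_left_mono) (auto simp: M_def)
  finally show ?thesis by (simp add: M_def)
qed

text \<open>
  A value \<open>v\<close> is compared with the average of \<open>A\<close> against the kernel centred at \<open>x\<^sub>0\<close>. Two small
  errors appear: the deviation of \<open>A\<close> from \<open>v\<close>, measured by the second moment of the kernel, and the
  average itself, which is a polynomial moment of \<open>A\<close>. The kernel is stretched to \<open>[x\<^sub>0 - 2, x\<^sub>0 + 2]\<close>,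
  which contains \<open>[-1, 1]\<close>; as \<open>A\<close> vanishes elsewhere, only \<open>[-1, 1]\<close> contributes.
\<close>

lemma jackson_recovery:
  fixes A :: "real \<Rightarrow> complex"
  assumes cont: "continuous_on UNIV A"
    and x0: "\<bar>x\<^sub>0\<bar> \<le> 1"
    and zero: "\<And>x. 1 < \<bar>x\<bar> \<Longrightarrow> A x = 0"
    and near: "\<And>x. \<bar>x\<bar> \<le> 3 \<Longrightarrow> norm (v - A x) \<le> a + b * (x - x\<^sub>0)\<^sup>2"
    and b: "0 \<le> b"
  shows "norm v \<le> a + 256 * b / (2 * real m + 1)\<^sup>2
     + 4 * norm (integral {-1..1} (\<lambda>x. poly (pcompose (jackson m) [:-x\<^sub>0 / 2, 1 / 2:]) x *\<^sub>R A x))"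
proof -
  define K where "K = poly (jackson m)"
  define S where "S = integral {-1..1} K"
  define P where "P = integral {-1..1} (\<lambda>x. K ((x - x\<^sub>0) / 2) *\<^sub>R A x)"
  have P_eq: "P = integral {-1..1} (\<lambda>x. poly (pcompose (jackson m) [:-x\<^sub>0 / 2, 1 / 2:]) x *\<^sub>R A x)"
    by (simp add: P_def K_def poly_pcompose field_simps)
  have contK: "continuous_on X (\<lambda>u. K (g u))" if "continuous_on X g" for X and g :: "real \<Rightarrow> real"
    unfolding K_def using that by (intro continuous_intros)
  have contK': "continuous_on X K" for X
    using contK[of X "\<lambda>u. u"] by (simp add: continuous_on_id)
  have contA: "continuous_on X (\<lambda>u. A (g u))" if "continuous_on X g" for X and g :: "real \<Rightarrow> real"
    using that by (intro continuous_on_compose2[OF cont]) auto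
  note int = integrable_continuous_real continuous_intros contK contK' contA
  have "1 / 8 * 1 \<le> 1 / 8 * (2 * real m + 1) ^ 3"
    by (intro mult_left_mono one_le_power) auto
  then have S: "1 / 8 \<le> S"
    using jackson_mass[of m] unfolding S_def K_def by linarith
  have "((\<lambda>x. K ((x - x\<^sub>0) / 2) *\<^sub>R A x) has_integral P) {-1..1}"
    unfolding P_def by (intro integrable_integral int) auto
  then have "((\<lambda>x. K ((x - x\<^sub>0) / 2) *\<^sub>R A x) has_integral P) (cbox (x\<^sub>0 - 2) (x\<^sub>0 + 2))"
    by (rule has_integral_on_superset) (use x0 zero in auto)
  from has_integral_affinity'[OF this, of 2 x\<^sub>0]
  have shifted: "integral {-1..1} (\<lambda>u. K u *\<^sub>R A (2 * u + x\<^sub>0)) = P /\<^sub>R 2"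
    by (simp add: integral_unique)
  have "S *\<^sub>R v = integral {-1..1} (\<lambda>u. K u *\<^sub>R v)"
    unfolding S_def by (intro integral_unique[symmetric] has_integral_scaleR_left integrable_integral int)
  also have "\<dots> = integral {-1..1} (\<lambda>u. K u *\<^sub>R (v - A (2 * u + x\<^sub>0)) + K u *\<^sub>R A (2 * u + x\<^sub>0))"
    by (simp add: scaleR_diff_right)
  also have "\<dots> = integral {-1..1} (\<lambda>u. K u *\<^sub>R (v - A (2 * u + x\<^sub>0))) + P /\<^sub>R 2"
    unfolding shifted[symmetric] by (intro Henstock_Kurzweil_Integration.integral_add int)
  finally have decomposition:
    "S *\<^sub>R v = integral {-1..1} (\<lambda>u. K u *\<^sub>R (v - A (2 * u + x\<^sub>0))) + P /\<^sub>R 2" .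
  have "S * norm v = norm (S *\<^sub>R v)" using S by simp
  also have "\<dots> = norm (integral {-1..1} (\<lambda>u. K u *\<^sub>R (v - A (2 * u + x\<^sub>0))) + P /\<^sub>R 2)"
    by (simp only: decomposition)
  also have "\<dots> \<le> norm (integral {-1..1} (\<lambda>u. K u *\<^sub>R (v - A (2 * u + x\<^sub>0)))) + norm P / 2"
    by (rule order_trans[OF norm_triangle_ineq]) simp
  also have "norm (integral {-1..1} (\<lambda>u. K u *\<^sub>R (v - A (2 * u + x\<^sub>0))))
      \<le> integral {-1..1} (\<lambda>u. a * K u + 4 * b * (u\<^sup>2 * K u))"
  proof (rule integral_norm_bound_integral)
    fix u :: real assume "u \<in> {-1..1}"
    then have "norm (v - A (2 * u + x\<^sub>0)) \<le> a + b * (2 * u + x\<^sub>0 - x\<^sub>0)\<^sup>2"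
      using x0 by (intro near) auto
    from mult_left_mono[OF this jackson_nonneg[of m u]]
    have "K u * norm (v - A (2 * u + x\<^sub>0)) \<le> a * K u + 4 * b * (u\<^sup>2 * K u)"
      by (simp add: K_def algebra_simps power2_eq_square)
    then show "norm (K u *\<^sub>R (v - A (2 * u + x\<^sub>0))) \<le> a * K u + 4 * b * (u\<^sup>2 * K u)"
      using jackson_nonneg[of m u] by (simp add: K_def)
  qed (intro int)+
  also have "\<dots> = a * S + 4 * b * integral {-1..1} (\<lambda>u. u\<^sup>2 * K u)"
    unfolding S_def
    by (subst Henstock_Kurzweil_Integration.integral_add) (auto intro!: int)
  also have "\<dots> \<le> a * S + 4 * b * (64 / (2 * real m + 1)\<^sup>2 * S)"
    using jackson_second_moment[of m] b unfolding S_def K_def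
    by (intro add_left_mono mult_left_mono) auto
  finally have "S * norm v \<le> S * (a + 256 * b / (2 * real m + 1)\<^sup>2) + norm P / 2"
    by (simp add: algebra_simps)
  also have "norm P / 2 \<le> S * (4 * norm P)"
    using mult_right_mono[OF S, of "4 * norm P"] by simp
  finally have "S * norm v \<le> S * (a + 256 * b / (2 * real m + 1)\<^sup>2 + 4 * norm P)"
    by (simp add: algebra_simps)
  then show ?thesis unfolding P_eq[symmetric] using S by simp
qed

section \<open>Vertical primitives and line integrals\<close>

text \<open>
  The vertical primitive \<open>\<integral> u (x, r) dr\<close> over \<open>r \<le> y\<close>, valid for \<open>y < 1\<close> if \<open>u\<close> vanishes for
  \<open>y < 0\<close>. The window has fixed length because then the operator is an average of translations of the
  plane: it preserves continuity everywhere, commutes with integration along parallel lines, and its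
  iterates do not increase suprema.
\<close>

definition primitive :: "(real \<times> real \<Rightarrow> complex) \<Rightarrow> real \<times> real \<Rightarrow> complex" where
  "primitive u = (\<lambda>(x, y). integral {0..1} (\<lambda>s. u (x, y - s)))"

lemma primitive_apply: "primitive u (x, y) = integral {0..1} (\<lambda>s. u (x, y - s))"
  by (simp add: primitive_def)

lemma continuous_on_primitive:
  assumes "continuous_on UNIV u"
  shows "continuous_on UNIV (primitive u)"
proof -
  have "continuous_on (UNIV \<times> cbox 0 1) (\<lambda>(p, s). u (fst p, snd p - s))"
    unfolding split_beta
    by (intro continuous_on_compose2[OF assms] continuous_intros) auto
  from integral_continuous_on_param[OF this] show ?thesis
    by (simp add: primitive_def split_beta)
qed

lemma continuous_on_primitive_power:
  assumes "continuous_on UNIV u"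
  shows "continuous_on UNIV ((primitive ^^ k) u)"
  using assms by (induction k) (auto intro: continuous_on_primitive)

lemma primitive_eq_0:
  assumes "\<And>y. y < 0 \<Longrightarrow> u (x, y) = 0" "y < 0"
  shows "(primitive ^^ k) u (x, y) = 0"
  using assms(2)
proof (induction k arbitrary: y)
  case (Suc k)
  have "primitive ((primitive ^^ k) u) (x, y) = integral {0..1::real} (\<lambda>_. 0)"
    unfolding primitive_apply by (intro integral_cong Suc.IH) (use Suc.prems in auto)
  then show ?case by simp
qed (use assms(1) in auto)

lemma primitive_eq_integral:
  "primitive u (x, y) = integral {y - 1..y} (\<lambda>s. u (x, s))"
proof -
  have "integral {y - 1..y} (\<lambda>s. u (x, s)) = integral {-1..0} ((\<lambda>s. u (x, s)) \<circ> (+) y)"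
    by (simp add: integral_shift_Icc_real add.commute)
  also have "\<dots> = integral {0..1} (\<lambda>s. u (x, y - s))"
    using Henstock_Kurzweil_Integration.integral_reflect_real[of 1 0 "\<lambda>s. u (x, y - s)"]
    by (simp add: o_def)
  finally show ?thesis by (simp add: primitive_def)
qed

text \<open>
  Near \<open>y < 1\<close> the lower end \<open>y - 1\<close> of the window is negative, where \<open>u\<close> vanishes, so it can be
  replaced by a constant.
\<close>

lemma primitive_has_derivative:
  assumes cont: "continuous_on UNIV u"
    and zero: "\<And>s. s < 0 \<Longrightarrow> u (x, s) = 0" and y: "y < 1"
  shows "((\<lambda>y. primitive u (x, y)) has_vector_derivative u (x, y)) (at y)"
proof -
  have cont': "continuous_on A (\<lambda>s. u (x, s))" for A
    by (intro continuous_on_compose2[OF cont] continuous_intros) auto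
  \<comment> \<open>Any constant below the windows of all points near \<open>y\<close> would do.\<close>
  define c where "c = y - 3"
  have "((\<lambda>z. integral {c..z} (\<lambda>s. u (x, s))) has_vector_derivative u (x, y)) (at y within {c..1})"
    by (rule integral_has_vector_derivative[OF cont']) (use y in \<open>auto simp: c_def\<close>)
  then have "((\<lambda>z. integral {c..z} (\<lambda>s. u (x, s))) has_vector_derivative u (x, y)) (at y)"
    using y by (simp add: c_def at_within_Icc_at)
  then show ?thesis
  proof (rule has_vector_derivative_transform_within_open)
    show "open {y - 1<..<1}" "y \<in> {y - 1<..<1}" using y by auto
    fix z assume z: "z \<in> {y - 1<..<1}"
    have "integral {c..z - 1} (\<lambda>s. u (x, s)) + integral {z - 1..z} (\<lambda>s. u (x, s))
        = integral {c..z} (\<lambda>s. u (x, s))"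
      using z by (intro Henstock_Kurzweil_Integration.integral_combine
          integrable_continuous_real cont') (auto simp: c_def)
    moreover have "integral {c..z - 1} (\<lambda>s. u (x, s)) = integral {c..z - 1} (\<lambda>s. 0)"
      using z by (intro integral_cong zero) auto
    ultimately show "integral {c..z} (\<lambda>s. u (x, s)) = primitive u (x, z)"
      by (simp add: primitive_eq_integral)
  qed
qed

text \<open>
  One integration bounds the value by the \<open>L\<^sup>1\<close> norm on the vertical segment; each further one
  averages over a window of length \<open>1\<close> and keeps this bound.
\<close>

lemma norm_primitive_power_le:
  assumes cont: "continuous_on UNIV u"
    and zero: "\<And>s. s \<le> -\<gamma> \<Longrightarrow> u (x, s) = 0" and y: "y \<le> \<gamma>" and \<gamma>: "0 < \<gamma>" and k: "0 < k"
  shows "norm ((primitive ^^ k) u (x, y)) \<le> integral {-\<gamma>..\<gamma>} (\<lambda>s. norm (u (x, s)))"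
  using k y
proof (induction k arbitrary: y rule: nat_induct_non_zero)
  case 1
  have cont': "continuous_on A (\<lambda>s. norm (u (x, s)))" for A
    by (intro continuous_on_compose2[OF cont] continuous_intros) auto
  have cont2: "continuous_on A (\<lambda>s. u (x, s))" for A
    by (intro continuous_on_compose2[OF cont] continuous_intros) auto
  define a where "a = min (y - 1) (-\<gamma>)"
  have "norm (primitive u (x, y)) \<le> integral {y - 1..y} (\<lambda>s. norm (u (x, s)))"
    unfolding primitive_eq_integral
    by (intro integral_norm_bound_integral integrable_continuous_real cont' cont2) auto
  also have "\<dots> \<le> integral {a..\<gamma>} (\<lambda>s. norm (u (x, s)))"
    using 1 by (intro integral_subset_le integrable_continuous_real cont') (auto simp: a_def)
  also have "\<dots> = integral {a..-\<gamma>} (\<lambda>s. norm (u (x, s))) + integral {-\<gamma>..\<gamma>} (\<lambda>s. norm (u (x, s)))"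
    using \<gamma> by (intro Henstock_Kurzweil_Integration.integral_combine[symmetric]
          integrable_continuous_real cont') (auto simp: a_def)
  also have "integral {a..-\<gamma>} (\<lambda>s. norm (u (x, s))) = integral {a..-\<gamma>} (\<lambda>s. 0)"
    by (intro integral_cong) (auto simp: zero)
  finally show ?case by simp
next
  case (Suc k)
  have cont': "continuous_on A (\<lambda>s. (primitive ^^ k) u (x, y - s))" for A
    by (intro continuous_on_compose2[OF continuous_on_primitive_power[OF cont]] continuous_intros) auto
  have "norm (primitive ((primitive ^^ k) u) (x, y))
      \<le> integral {0..1::real} (\<lambda>_. integral {-\<gamma>..\<gamma>} (\<lambda>s. norm (u (x, s))))"
    unfolding primitive_apply
    by (intro integral_norm_bound_integral integrable_continuous_real cont')
       (use Suc in auto)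
  then show ?case by simp
qed

text \<open>
  For functions supported in \<open>y \<ge> x\<^sup>2\<close> these truncated line integrals agree with the Radon transform
  on the lines of interest, and for a continuous function they are continuous on the whole plane.
\<close>

definition strip_radon :: "real \<Rightarrow> (real \<times> real \<Rightarrow> complex) \<Rightarrow> real \<times> real \<Rightarrow> complex" where
  "strip_radon B u = (\<lambda>(\<xi>, \<eta>). integral {-B..B} (\<lambda>x. u (x, \<xi> * x + \<eta>)))"

lemma continuous_on_strip_radon:
  assumes "continuous_on UNIV u"
  shows "continuous_on UNIV (strip_radon B u)"
proof -
  have "continuous_on (UNIV \<times> cbox (-B) B) (\<lambda>(p, x). u (x, fst p * x + snd p))"
    unfolding split_beta
    by (intro continuous_on_compose2[OF assms] continuous_intros) auto
  from integral_continuous_on_param[OF this] show ?thesis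
    by (simp add: strip_radon_def split_beta)
qed

lemma strip_radon_primitive:
  assumes "continuous_on UNIV u"
  shows "strip_radon B (primitive u) = primitive (strip_radon B u)"
proof
  fix p :: "real \<times> real"
  obtain \<xi> \<eta> where p: "p = (\<xi>, \<eta>)" by force
  have "continuous_on (cbox (-B, 0) (B, 1)) (\<lambda>(x, s). u (x, \<xi> * x + \<eta> - s))"
    unfolding split_beta
    by (intro continuous_on_compose2[OF assms] continuous_intros) auto
  from integral_swap_continuous[OF this]
  show "strip_radon B (primitive u) p = primitive (strip_radon B u) p"
    by (simp add: p strip_radon_def primitive_def add_diff_eq)
qed

lemma strip_radon_primitive_power:
  assumes "continuous_on UNIV u"
  shows "strip_radon B ((primitive ^^ k) u) = (primitive ^^ k) (strip_radon B u)"
  using assms by (induction k) (auto simp: strip_radon_primitive continuous_on_primitive_power)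

text \<open>
  Along the line through \<open>(0, \<gamma>)\<close> with slope \<open>\<xi>\<close>, the derivative in \<open>\<xi>\<close> of the vertical primitive at
  abscissa \<open>x\<close> is \<open>x\<close> times the function. Integrating by parts in \<open>\<xi>\<close> therefore trades a factor \<open>x\<close>
  for a derivative of the weight.
\<close>

lemma integral_by_parts_line:
  fixes w :: "real poly"
  assumes cont: "continuous_on UNIV u"
    and zero: "\<And>s. s < 0 \<Longrightarrow> u (x, s) = 0"
    and line: "\<gamma> + h * \<bar>x\<bar> < 1" and h: "0 < h"
    and w: "poly w h = 0" "poly w (-h) = 0"
  shows "x *\<^sub>R integral {-h..h} (\<lambda>\<xi>. poly w \<xi> *\<^sub>R u (x, \<gamma> + \<xi> * x))
       = - integral {-h..h} (\<lambda>\<xi>. poly (pderiv w) \<xi> *\<^sub>R primitive u (x, \<gamma> + \<xi> * x))"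
proof -
  have cont': "continuous_on A (\<lambda>\<xi>. v (x, \<gamma> + \<xi> * x))" if "continuous_on UNIV v" for A
    and v :: "real \<times> real \<Rightarrow> complex"
    by (intro continuous_on_compose2[OF that] continuous_intros) auto
  have "((\<lambda>\<xi>. poly w \<xi> *\<^sub>R (x *\<^sub>R u (x, \<gamma> + \<xi> * x))
              + poly (pderiv w) \<xi> *\<^sub>R primitive u (x, \<gamma> + \<xi> * x)) has_integral
      (poly w h *\<^sub>R primitive u (x, \<gamma> + h * x) - poly w (-h) *\<^sub>R primitive u (x, \<gamma> + (-h) * x))) {-h..h}"
  proof (rule fundamental_theorem_of_calculus)
    fix \<xi> assume \<xi>: "\<xi> \<in> {-h..h}"
    have "\<xi> * x \<le> \<bar>\<xi>\<bar> * \<bar>x\<bar>" by (metis abs_ge_self abs_mult)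
    also have "\<dots> \<le> h * \<bar>x\<bar>" using \<xi> by (intro mult_right_mono) auto
    finally have "\<gamma> + \<xi> * x < 1" using line by linarith
    from primitive_has_derivative[OF cont zero this]
    have d: "((\<lambda>y. primitive u (x, y)) has_vector_derivative u (x, \<gamma> + \<xi> * x)) (at (\<gamma> + \<xi> * x))" .
    have "((\<lambda>\<xi>. \<gamma> + \<xi> * x) has_vector_derivative x) (at \<xi>)"
      by (auto intro!: derivative_eq_intros simp: has_real_derivative_iff_has_vector_derivative[symmetric])
    from vector_diff_chain_at[OF this d]
    have "((\<lambda>\<xi>. primitive u (x, \<gamma> + \<xi> * x)) has_vector_derivative x *\<^sub>R u (x, \<gamma> + \<xi> * x)) (at \<xi>)"
      by (simp add: o_def)
    from has_vector_derivative_scaleR[OF poly_DERIV this, of w]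
    show "((\<lambda>\<xi>. poly w \<xi> *\<^sub>R primitive u (x, \<gamma> + \<xi> * x)) has_vector_derivative
        poly w \<xi> *\<^sub>R (x *\<^sub>R u (x, \<gamma> + \<xi> * x)) + poly (pderiv w) \<xi> *\<^sub>R primitive u (x, \<gamma> + \<xi> * x))
        (at \<xi> within {-h..h})"
      by (rule has_vector_derivative_at_within)
  qed (use h in auto)
  then have "integral {-h..h} (\<lambda>\<xi>. poly w \<xi> *\<^sub>R (x *\<^sub>R u (x, \<gamma> + \<xi> * x))
              + poly (pderiv w) \<xi> *\<^sub>R primitive u (x, \<gamma> + \<xi> * x)) = 0"
    using w by (simp add: integral_unique)
  then have "integral {-h..h} (\<lambda>\<xi>. poly w \<xi> *\<^sub>R (x *\<^sub>R u (x, \<gamma> + \<xi> * x)))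
      + integral {-h..h} (\<lambda>\<xi>. poly (pderiv w) \<xi> *\<^sub>R primitive u (x, \<gamma> + \<xi> * x)) = 0"
    by (subst (asm) Henstock_Kurzweil_Integration.integral_add)
       (auto intro!: integrable_continuous_real continuous_intros cont' cont continuous_on_primitive)
  moreover have "integral {-h..h} (\<lambda>\<xi>. poly w \<xi> *\<^sub>R (x *\<^sub>R u (x, \<gamma> + \<xi> * x)))
      = x *\<^sub>R integral {-h..h} (\<lambda>\<xi>. poly w \<xi> *\<^sub>R u (x, \<gamma> + \<xi> * x))"
    by (simp only: scaleR_left_commute[of _ x] integral_cmul)
  ultimately show ?thesis by (simp add: eq_neg_iff_add_eq_0)
qed

section \<open>Polynomial weights on slopes\<close>

text \<open>
  A polynomial weight \<open>(1 - (\<xi> / h)\<^sup>2)\<^sup>n\<close> on slopes \<open>\<bar>\<xi>\<bar> \<le> h\<close>. Its zeros of order \<open>n\<close> at \<open>\<plusminus>h\<close> remove the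
  boundary terms in \<open>n\<close> integrations by parts.
\<close>

definition bump :: "real \<Rightarrow> nat \<Rightarrow> real poly" where
  "bump h n = [:1, 0, - (1 / h\<^sup>2):] ^ n"

lemma poly_bump: "poly (bump h n) \<xi> = (1 - (\<xi> / h)\<^sup>2) ^ n"
  by (simp add: bump_def poly_power power2_eq_square)

lemma degree_bump: "degree (bump h n) \<le> 2 * n"
  unfolding bump_def
  by (rule order_trans[OF degree_power_le]) simp

lemma bump_dvd_higher_pderiv:
  assumes "k \<le> n"
  shows "[:1, 0, - (1 / h\<^sup>2):] ^ (n - k) dvd (pderiv ^^ k) (bump h n)"
  using assms
proof (induction k)
  case (Suc k)
  let ?b = "[:1, 0, - (1 / h\<^sup>2):]"
  obtain r where r: "(pderiv ^^ k) (bump h n) = ?b ^ (n - k) * r"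
    using Suc by (auto elim: dvdE)
  have nk: "n - k = Suc (n - Suc k)" using Suc by simp
  have "(pderiv ^^ Suc k) (bump h n)
      = ?b ^ (n - Suc k) * (?b * pderiv r + smult (of_nat (n - k)) (pderiv ?b * r))"
    by (simp add: r pderiv_mult nk pderiv_power_Suc algebra_simps del: pderiv_pCons power_Suc mult_pCons_left mult_pCons_right)
       (simp add: algebra_simps del: pderiv_pCons mult_pCons_left mult_pCons_right)
  then show ?case by (metis dvd_triv_left)
qed (simp add: bump_def)

lemma higher_pderiv_bump_at_ends:
  assumes "k < n" "h \<noteq> 0"
  shows "poly ((pderiv ^^ k) (bump h n)) h = 0" "poly ((pderiv ^^ k) (bump h n)) (-h) = 0"
proof -
  obtain r where r: "(pderiv ^^ k) (bump h n) = [:1, 0, - (1 / h\<^sup>2):] ^ (n - k) * r"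
    using bump_dvd_higher_pderiv[of k n h] assms by (auto elim: dvdE)
  show "poly ((pderiv ^^ k) (bump h n)) h = 0" "poly ((pderiv ^^ k) (bump h n)) (-h) = 0"
    using assms unfolding r by (auto simp: poly_power power2_eq_square zero_power)
qed

text \<open>
  The monomial moment of the slope-averaged function is turned into an integral of the \<open>k\<close>-th
  primitive. After integration in \<open>x\<close> the right-hand side involves only the Radon data.
\<close>

lemma moment_by_parts:
  assumes cont: "continuous_on UNIV u"
    and zero: "\<And>s. s < 0 \<Longrightarrow> u (x, s) = 0"
    and line: "\<gamma> + h * \<bar>x\<bar> < 1" and h: "0 < h" and k: "k \<le> n"
  shows "x ^ k *\<^sub>R integral {-h..h} (\<lambda>\<xi>. poly (bump h n) \<xi> *\<^sub>R u (x, \<gamma> + \<xi> * x))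
       = (-1) ^ k *\<^sub>R integral {-h..h}
           (\<lambda>\<xi>. poly ((pderiv ^^ k) (bump h n)) \<xi> *\<^sub>R (primitive ^^ k) u (x, \<gamma> + \<xi> * x))"
  using k
proof (induction k)
  case (Suc k)
  let ?I = "\<lambda>k. integral {-h..h}
      (\<lambda>\<xi>. poly ((pderiv ^^ k) (bump h n)) \<xi> *\<^sub>R (primitive ^^ k) u (x, \<gamma> + \<xi> * x))"
  have "x *\<^sub>R ?I k = - ?I (Suc k)"
    using integral_by_parts_line[OF continuous_on_primitive_power[OF cont] primitive_eq_0[where u = u and x = x] line h
        higher_pderiv_bump_at_ends[of k n h], of k] Suc h zero
    by simp
  moreover have IH: "x ^ k *\<^sub>R ?I 0 = (-1) ^ k *\<^sub>R ?I k" using Suc by simp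
  have "x ^ Suc k *\<^sub>R ?I 0 = x *\<^sub>R (x ^ k *\<^sub>R ?I 0)" by simp
  then have "x ^ Suc k *\<^sub>R ?I 0 = x *\<^sub>R ((-1) ^ k *\<^sub>R ?I k)" by (simp only: IH)
  moreover have "\<dots> = (-1) ^ k *\<^sub>R (x *\<^sub>R ?I k)" by (rule scaleR_left_commute)
  ultimately have "x ^ Suc k *\<^sub>R ?I 0 = (-1) ^ Suc k *\<^sub>R ?I (Suc k)" by simp
  then show ?case by simp
qed simp

lemma bump_nonneg:
  assumes "\<bar>\<xi>\<bar> \<le> h"
  shows "0 \<le> poly (bump h n) \<xi>"
proof -
  have "\<bar>\<xi> / h\<bar> \<le> 1" using assms by (auto simp: abs_divide divide_le_eq)
  then have "(\<xi> / h)\<^sup>2 \<le> 1" by (simp add: abs_square_le_1)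
  then show ?thesis unfolding poly_bump by simp
qed

text \<open>
  By Bernoulli's inequality the weight is at least \<open>1/2\<close> for \<open>\<bar>\<xi>\<bar> \<le> h / n\<close>.
\<close>

lemma bump_mass:
  assumes h: "0 < h" and n: "2 \<le> n"
  shows "h / real n \<le> integral {-h..h} (poly (bump h n))"
proof -
  have "h / real n = integral {-(h / n)..h / n} (\<lambda>_. 1 / 2)"
    using h by simp
  also have "\<dots> \<le> integral {-(h / n)..h / n} (poly (bump h n))"
  proof (rule integral_le)
    fix \<xi> assume "\<xi> \<in> {-(h / n)..h / n}"
    then have "\<bar>\<xi> / h\<bar> \<le> 1 / n" using h by (auto simp: abs_if field_simps)
    from power_mono[OF this, of 2] have sq: "(\<xi> / h)\<^sup>2 \<le> 1 / (real n)\<^sup>2"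
      by (simp add: power_divide)
    also have "\<dots> \<le> 1" using n by (simp add: field_simps)
    finally have "1 + real n * - (\<xi> / h)\<^sup>2 \<le> (1 + - (\<xi> / h)\<^sup>2) ^ n"
      by (intro Bernoulli_inequality) simp
    moreover have "real n * (\<xi> / h)\<^sup>2 \<le> 1 / real n"
      using mult_left_mono[OF sq, of "real n"] n by (simp add: power2_eq_square)
    moreover have "1 / real n \<le> 1 / 2" using n by (simp add: field_simps)
    ultimately show "1 / 2 \<le> poly (bump h n) \<xi>" by (simp add: poly_bump)
  qed (auto intro!: integrable_continuous_real continuous_intros)
  also have "\<dots> \<le> integral {-h..h} (poly (bump h n))"
  proof (rule integral_subset_le)
    have "h / n \<le> h" using h n by (simp add: divide_le_eq)
    then show "{-(h / n)..h / n} \<subseteq> {-h..h}" by auto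
    show "\<forall>\<xi>\<in>{-h..h}. 0 \<le> poly (bump h n) \<xi>"
      by (auto intro!: bump_nonneg)
  qed (auto intro!: integrable_continuous_real continuous_intros)
  finally show ?thesis .
qed

text \<open>
  Differentiation of a polynomial of degree \<open>2 n\<close> multiplies its coefficient norm by at most \<open>2 n\<close>.
  For \<open>h = 1 / n\<close> the bound is of the form \<open>n\<^sup>O\<^sup>(\<^sup>n\<^sup>)\<close>; this growth is what produces the iterated
  logarithm in the final rate.
\<close>

lemma higher_pderiv_bump_le:
  assumes h: "0 < h" "h \<le> 1" and \<xi>: "\<bar>\<xi>\<bar> \<le> h" and k: "k \<le> n" and n: "0 < n"
  shows "\<bar>poly ((pderiv ^^ k) (bump h n)) \<xi>\<bar> \<le> (2 * real n) ^ n * (2 / h\<^sup>2) ^ n"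
proof -
  have h2: "1 \<le> 1 / h\<^sup>2" using h by (simp add: field_simps power_le_one)
  have "coeff_norm [:1, 0, - (1 / h\<^sup>2):] \<le> 2 / h\<^sup>2"
    using h2 by simp
  then have cb: "coeff_norm (bump h n) \<le> (2 / h\<^sup>2) ^ n"
    unfolding bump_def
    by (intro order_trans[OF coeff_norm_power] power_mono coeff_norm_nonneg)
  have "real (degree (bump h n)) ^ k \<le> (2 * real n) ^ k"
    using degree_bump[of h n] by (intro power_mono) auto
  also have "\<dots> \<le> (2 * real n) ^ n"
    using n k by (intro power_increasing) auto
  finally have d: "real (degree (bump h n)) ^ k \<le> (2 * real n) ^ n" .
  have "\<bar>poly ((pderiv ^^ k) (bump h n)) \<xi>\<bar> \<le> coeff_norm ((pderiv ^^ k) (bump h n))"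
    using h \<xi> by (intro abs_poly_le_coeff_norm) auto
  also have "\<dots> \<le> real (degree (bump h n)) ^ k * coeff_norm (bump h n)"
    by (rule coeff_norm_higher_pderiv)
  also have "\<dots> \<le> (2 * real n) ^ n * (2 / h\<^sup>2) ^ n"
    using d cb by (intro mult_mono) (auto simp: coeff_norm_nonneg)
  finally show ?thesis .
qed

text \<open>
  The polynomial moments of the slope-averaged function are controlled by the Radon data alone:
  after \<open>k\<close> integrations by parts the integral in \<open>x\<close> is taken along lines, and it commutes with the
  primitives. The moment of order \<open>0\<close> uses the data on the edge \<open>\<eta> = \<gamma>\<close>, the others use the data on
  the rectangle.
\<close>

lemma polynomial_moment_le:
  assumes cont: "continuous_on UNIV u"
    and zero: "\<And>x s. s < 0 \<Longrightarrow> u (x, s) = 0"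
    and \<gamma>: "h < \<gamma>" "\<gamma> + h < 1" and h: "0 < h"
    and q: "degree q \<le> n"
    and W: "\<And>k \<xi>. k \<le> n \<Longrightarrow> \<bar>\<xi>\<bar> \<le> h \<Longrightarrow> \<bar>poly ((pderiv ^^ k) (bump h n)) \<xi>\<bar> \<le> W"
    and edge: "integral {-h..h} (\<lambda>\<xi>. norm (strip_radon 1 u (\<xi>, \<gamma>))) \<le> D"
    and rect: "integral {-h..h} (\<lambda>\<xi>. integral {-\<gamma>..\<gamma>} (\<lambda>\<eta>. norm (strip_radon 1 u (\<xi>, \<eta>)))) \<le> D"
  shows "norm (integral {-1..1} (\<lambda>x. poly q x *\<^sub>R
           integral {-h..h} (\<lambda>\<xi>. poly (bump h n) \<xi> *\<^sub>R u (x, \<gamma> + \<xi> * x))))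
       \<le> coeff_norm q * (W * D)"
proof -
  define g where "g = strip_radon 1 u"
  define w where "w = (\<lambda>k. poly ((pderiv ^^ k) (bump h n)))"
  define I where "I = (\<lambda>x. integral {-h..h} (\<lambda>\<xi>. w 0 \<xi> *\<^sub>R u (x, \<gamma> + \<xi> * x)))"
  define Ik where "Ik = (\<lambda>k x. integral {-h..h} (\<lambda>\<xi>. w k \<xi> *\<^sub>R (primitive ^^ k) u (x, \<gamma> + \<xi> * x)))"
  note contk = continuous_on_primitive_power[OF cont]
  have contg: "continuous_on UNIV g" unfolding g_def by (rule continuous_on_strip_radon[OF cont])
  have contw: "continuous_on X (\<lambda>p. w k (r p))" if "continuous_on X r"
    for X :: "(real \<times> real) set" and k and r :: "real \<times> real \<Rightarrow> real"
    unfolding w_def using that by (intro continuous_intros)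
  have contw': "continuous_on X (w k)" for X k
    unfolding w_def by (intro continuous_intros)
  have contIk: "continuous_on UNIV (Ik k)" for k
  proof -
    have "continuous_on (UNIV \<times> cbox (-h) h) (\<lambda>(x, \<xi>). w k \<xi> *\<^sub>R (primitive ^^ k) u (x, \<gamma> + \<xi> * x))"
      unfolding split_beta
      by (intro continuous_intros contw continuous_on_compose2[OF contk]) auto
    from integral_continuous_on_param[OF this] show ?thesis by (simp add: Ik_def)
  qed
  have swap: "integral {-1..1} (Ik k) = integral {-h..h} (\<lambda>\<xi>. w k \<xi> *\<^sub>R (primitive ^^ k) g (\<xi>, \<gamma>))" for k
  proof -
    have "continuous_on (cbox (-1, -h) (1, h)) (\<lambda>(x, \<xi>). w k \<xi> *\<^sub>R (primitive ^^ k) u (x, \<gamma> + \<xi> * x))"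
      unfolding split_beta
      by (intro continuous_intros contw continuous_on_compose2[OF contk]) auto
    from integral_swap_continuous[OF this]
    have "integral {-1..1} (Ik k) = integral {-h..h}
        (\<lambda>\<xi>. integral {-1..1} (\<lambda>x. w k \<xi> *\<^sub>R (primitive ^^ k) u (x, \<gamma> + \<xi> * x)))"
      by (simp add: Ik_def)
    also have "\<dots> = integral {-h..h} (\<lambda>\<xi>. w k \<xi> *\<^sub>R strip_radon 1 ((primitive ^^ k) u) (\<xi>, \<gamma>))"
      by (simp add: strip_radon_def add.commute)
    finally show ?thesis by (simp add: strip_radon_primitive_power[OF cont] g_def)
  qed
  have g0: "g (\<xi>, s) = 0" if "\<bar>\<xi>\<bar> \<le> h" "s \<le> -\<gamma>" for \<xi> s
  proof -
    have "g (\<xi>, s) = integral {-1..1::real} (\<lambda>_. 0)"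
      unfolding g_def strip_radon_def split
    proof (intro integral_cong zero)
      fix x :: real assume "x \<in> {-1..1}"
      then have "\<bar>\<xi> * x\<bar> \<le> h * 1" using that unfolding abs_mult by (intro mult_mono) auto
      then show "\<xi> * x + s < 0" using that \<gamma> by linarith
    qed
    then show ?thesis by simp
  qed
  have contn: "continuous_on X (\<lambda>\<xi>. norm ((primitive ^^ k) g (\<xi>, \<gamma>)))" for X k
    by (intro continuous_intros continuous_on_compose2[OF continuous_on_primitive_power[OF contg]]) auto
  have "continuous_on (UNIV \<times> cbox (-\<gamma>) \<gamma>) (\<lambda>(\<xi>, \<eta>). norm (g (\<xi>, \<eta>)))"
    unfolding split_beta by (intro continuous_intros continuous_on_compose2[OF contg]) auto
  from integral_continuous_on_param[OF this]
  have contL: "continuous_on X (\<lambda>\<xi>. integral {-\<gamma>..\<gamma>} (\<lambda>\<eta>. norm (g (\<xi>, \<eta>))))" for X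
    by (auto intro: continuous_on_subset)
  have D: "integral {-h..h} (\<lambda>\<xi>. norm ((primitive ^^ k) g (\<xi>, \<gamma>))) \<le> D" for k
  proof (cases "k = 0")
    case False
    have "integral {-h..h} (\<lambda>\<xi>. norm ((primitive ^^ k) g (\<xi>, \<gamma>)))
        \<le> integral {-h..h} (\<lambda>\<xi>. integral {-\<gamma>..\<gamma>} (\<lambda>\<eta>. norm (g (\<xi>, \<eta>))))"
      using False g0 \<gamma> h
      by (intro integral_le integrable_continuous_real contn contL norm_primitive_power_le contg) auto
    with rect show ?thesis by (simp add: g_def)
  qed (use edge in \<open>simp add: g_def\<close>)
  have W0: "0 \<le> W" using W[of 0 0] h by auto
  have Ik_le: "norm (integral {-1..1} (Ik k)) \<le> W * D" if "k \<le> n" for k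
  proof -
    have "norm (integral {-1..1} (Ik k)) \<le> integral {-h..h} (\<lambda>\<xi>. W * norm ((primitive ^^ k) g (\<xi>, \<gamma>)))"
      unfolding swap
    proof (rule integral_norm_bound_integral)
      show "norm (w k \<xi> *\<^sub>R (primitive ^^ k) g (\<xi>, \<gamma>)) \<le> W * norm ((primitive ^^ k) g (\<xi>, \<gamma>))"
        if "\<xi> \<in> {-h..h}" for \<xi>
        unfolding norm_scaleR w_def using W[OF \<open>k \<le> n\<close>, of \<xi>] that by (intro mult_right_mono) auto
    qed (auto intro!: integrable_continuous_real continuous_intros contw' contn
          continuous_on_compose2[OF continuous_on_primitive_power[OF contg]])
    also have "\<dots> = W * integral {-h..h} (\<lambda>\<xi>. norm ((primitive ^^ k) g (\<xi>, \<gamma>)))"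
      by simp
    also have "\<dots> \<le> W * D" using D W0 by (rule mult_left_mono)
    finally show ?thesis .
  qed
  have "integral {-1..1} (\<lambda>x. poly q x *\<^sub>R I x)
      = integral {-1..1} (\<lambda>x. \<Sum>k\<le>degree q. (coeff q k * (-1) ^ k) *\<^sub>R Ik k x)"
  proof (intro integral_cong)
    fix x :: real assume x: "x \<in> {-1..1}"
    then have "h * \<bar>x\<bar> \<le> h * 1" using h by (intro mult_left_mono) auto
    then have line: "\<gamma> + h * \<bar>x\<bar> < 1" using \<gamma> by simp
    have "x ^ k *\<^sub>R I x = (-1) ^ k *\<^sub>R Ik k x" if "k \<le> degree q" for k
      unfolding I_def Ik_def w_def funpow_0
      using moment_by_parts[OF cont zero line h, of k n] that q by simp
    then show "poly q x *\<^sub>R I x = (\<Sum>k\<le>degree q. (coeff q k * (-1) ^ k) *\<^sub>R Ik k x)"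
      by (simp add: poly_altdef scaleR_sum_left flip: scaleR_scaleR)
  qed
  also have "\<dots> = (\<Sum>k\<le>degree q. (coeff q k * (-1) ^ k) *\<^sub>R integral {-1..1} (Ik k))"
    by (subst integral_sum)
       (auto intro!: integrable_continuous_real continuous_intros continuous_on_subset[OF contIk])
  finally have "norm (integral {-1..1} (\<lambda>x. poly q x *\<^sub>R I x))
      \<le> (\<Sum>k\<le>degree q. norm ((coeff q k * (-1) ^ k) *\<^sub>R integral {-1..1} (Ik k)))"
    by (metis norm_sum)
  also have "\<dots> \<le> (\<Sum>k\<le>degree q. \<bar>coeff q k\<bar> * (W * D))"
    using q by (intro sum_mono) (auto simp: abs_mult intro!: mult_left_mono Ik_le)
  also have "\<dots> = coeff_norm q * (W * D)"
    by (simp add: coeff_norm_def sum_distrib_right)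
  finally show ?thesis by (simp add: I_def w_def)
qed

section \<open>Stability at a fixed scale\<close>

lemma weighted_average_near:
  fixes \<phi> :: "real \<Rightarrow> complex"
  assumes w: "continuous_on {a..b} w" "\<And>\<xi>. \<xi> \<in> {a..b} \<Longrightarrow> 0 \<le> w \<xi>" "0 < integral {a..b} w"
    and \<phi>: "continuous_on {a..b} \<phi>" "\<And>\<xi>. \<xi> \<in> {a..b} \<Longrightarrow> norm (v - \<phi> \<xi>) \<le> E"
  shows "norm (v - integral {a..b} (\<lambda>\<xi>. w \<xi> *\<^sub>R \<phi> \<xi>) /\<^sub>R integral {a..b} w) \<le> E"
proof -
  define Z where "Z = integral {a..b} w"
  note int = integrable_continuous_real continuous_intros w(1) \<phi>(1)
  have "Z *\<^sub>R v = integral {a..b} (\<lambda>\<xi>. w \<xi> *\<^sub>R v)"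
    unfolding Z_def by (intro integral_unique[symmetric] has_integral_scaleR_left integrable_integral int)
  then have "Z *\<^sub>R v - integral {a..b} (\<lambda>\<xi>. w \<xi> *\<^sub>R \<phi> \<xi>) = integral {a..b} (\<lambda>\<xi>. w \<xi> *\<^sub>R v - w \<xi> *\<^sub>R \<phi> \<xi>)"
    by (simp only:, intro Henstock_Kurzweil_Integration.integral_diff[symmetric] int)
  also have "norm \<dots> \<le> integral {a..b} (\<lambda>\<xi>. w \<xi> * E)"
  proof (rule integral_norm_bound_integral)
    fix \<xi> assume "\<xi> \<in> {a..b}"
    then show "norm (w \<xi> *\<^sub>R v - w \<xi> *\<^sub>R \<phi> \<xi>) \<le> w \<xi> * E"
      using w(2) \<phi>(2) by (simp add: scaleR_diff_right[symmetric] mult_left_mono)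
  qed (intro int)+
  also have "\<dots> = Z * E" by (simp add: Z_def)
  finally have "norm (Z *\<^sub>R v - integral {a..b} (\<lambda>\<xi>. w \<xi> *\<^sub>R \<phi> \<xi>)) \<le> Z * E" .
  moreover have "Z *\<^sub>R v - integral {a..b} (\<lambda>\<xi>. w \<xi> *\<^sub>R \<phi> \<xi>)
      = Z *\<^sub>R (v - integral {a..b} (\<lambda>\<xi>. w \<xi> *\<^sub>R \<phi> \<xi>) /\<^sub>R Z)"
    using w(3) by (simp add: Z_def scaleR_diff_right)
  ultimately show ?thesis using w(3) by (simp add: Z_def)
qed

text \<open>
  For \<open>\<alpha> \<le> 1\<close> a Hoelder modulus at scale \<open>h\<close> is dominated by a quadratic one, so that the second
  moment of the Jackson kernel suffices to treat it.
\<close>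

lemma powr_le_quadratic:
  fixes \<alpha> :: real
  assumes "0 < \<alpha>" "\<alpha> \<le> 1" "0 \<le> s" "0 < h"
  shows "s powr \<alpha> \<le> h powr \<alpha> * (1 + (s / h)\<^sup>2)"
proof -
  define z where "z = s / h"
  have z: "0 \<le> z" "s = h * z" using assms by (auto simp: z_def)
  have "z powr \<alpha> \<le> 1 + z\<^sup>2"
  proof (cases "z \<le> 1")
    case True
    then show ?thesis using powr_le1[of \<alpha> z] z assms by (simp add: add_increasing2)
  next
    case False
    then have "z powr \<alpha> \<le> z powr 1" using assms by (intro powr_mono) auto
    also have "\<dots> \<le> z\<^sup>2" using False by (simp add: power2_eq_square)
    finally show ?thesis by simp
  qed
  then show ?thesis
    using assms z unfolding z_def[symmetric] by (simp add: powr_mult mult_left_mono)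
qed

lemma amplification_le:
  assumes n: "8 \<le> n"
  shows "324 * 7 ^ n * (2 * real n) ^ n * (2 * (real n)\<^sup>2) ^ n * (real n)\<^sup>2 \<le> real n ^ (6 * n)"
proof -
  have "28 * real n ^ 3 \<le> (real n)\<^sup>2 * real n ^ 3"
    using n power_mono[of 8 "real n" 2] by (intro mult_right_mono) auto
  then have "28 * real n ^ 3 \<le> real n ^ 5"
    by (simp flip: power_add)
  then have a: "(28 * real n ^ 3) ^ n \<le> (real n ^ 5) ^ n" by (intro power_mono) auto
  have "324 * (real n)\<^sup>2 \<le> real n ^ 3 * (real n)\<^sup>2"
    using n power_mono[of 8 "real n" 3] by (intro mult_right_mono) auto
  also have "\<dots> = real n ^ 5" by (simp flip: power_add)
  also have "\<dots> \<le> real n ^ n" using n by (intro power_increasing) auto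
  finally have b: "324 * (real n)\<^sup>2 \<le> real n ^ n" .
  have "(28 * real n ^ 3) ^ n * (324 * (real n)\<^sup>2) \<le> (real n ^ 5) ^ n * real n ^ n"
    using a b by (rule mult_mono) auto
  also have "\<dots> = real n ^ (6 * n)"
    by (simp flip: power_mult power_add)
  also have "28 * real n ^ 3 = 7 * (2 * real n) * (2 * (real n)\<^sup>2)"
    by (simp add: power2_eq_square power3_eq_cube)
  also have "\<dots> ^ n * (324 * (real n)\<^sup>2)
      = 324 * 7 ^ n * (2 * real n) ^ n * (2 * (real n)\<^sup>2) ^ n * (real n)\<^sup>2"
    by (simp only: power_mult_distrib mult_ac)
  finally show ?thesis .
qed

text \<open>
  For \<open>\<bar>x\<bar> > 1\<close> the height \<open>\<eta> + \<xi> x\<close> on the line is less than \<open>(\<gamma> + h) \<bar>x\<bar>\<close>, hence less than \<open>x\<^sup>2\<close>.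
\<close>

lemma parabola_line_zero:
  fixes f :: "real \<times> real \<Rightarrow> complex"
  assumes zero: "\<And>x y. y < x\<^sup>2 \<Longrightarrow> f (x, y) = 0"
    and x: "1 < \<bar>x\<bar>" and \<xi>: "\<bar>\<xi>\<bar> \<le> h" and \<eta>: "\<eta> \<le> \<gamma>" and h: "\<gamma> + h \<le> \<bar>x\<bar>" and \<gamma>: "0 < \<gamma>"
  shows "f (x, \<eta> + \<xi> * x) = 0"
proof (rule zero)
  have "\<xi> * x \<le> h * \<bar>x\<bar>"
    using mult_right_mono[OF \<xi>, of "\<bar>x\<bar>"] abs_ge_self[of "\<xi> * x"] by (simp add: abs_mult)
  moreover have "\<gamma> < \<gamma> * \<bar>x\<bar>" using x \<gamma> by auto
  moreover have "(\<gamma> + h) * \<bar>x\<bar> \<le> \<bar>x\<bar> * \<bar>x\<bar>" using h by (intro mult_right_mono) auto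
  ultimately show "\<eta> + \<xi> * x < x\<^sup>2"
    using \<eta> x by (auto simp: power2_eq_square algebra_simps)
qed

text \<open>
  The stability estimate at a fixed scale \<open>h = 1 / n\<close>. Averaging \<open>f\<close> over lines through \<open>(0, \<gamma>)\<close> with
  slopes \<open>\<bar>\<xi>\<bar> \<le> h\<close> and then against a Jackson kernel of width \<open>O(h)\<close> moves points by \<open>O(h)\<close>, which costs
  \<open>O(C h\<^sup>\<alpha>)\<close>. The average is a polynomial moment of degree \<open>n\<close>, which costs \<open>n\<^sup>6\<^sup>n\<close> times the data.
\<close>

lemma slice_value_le:
  fixes f :: "real \<times> real \<Rightarrow> complex"
  assumes hoelder: "\<And>p q. norm (f p - f q) \<le> C * dist p q powr \<alpha>"
    and cont: "continuous_on UNIV f"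
    and \<alpha>: "0 < \<alpha>" "\<alpha> \<le> 1" and C: "0 \<le> C"
    and below: "\<And>x y. y < 0 \<Longrightarrow> f (x, y) = 0"
    and outside: "\<And>x \<xi>. 1 < \<bar>x\<bar> \<Longrightarrow> \<bar>\<xi>\<bar> \<le> h \<Longrightarrow> f (x, \<gamma> + \<xi> * x) = 0"
    and m: "1 \<le> m" and n_def: "n = 8 * m" and h_def: "h = 1 / real n"
    and \<gamma>: "h < \<gamma>" "\<gamma> + h < 1"
    and edge: "integral {-h..h} (\<lambda>\<xi>. norm (strip_radon 1 f (\<xi>, \<gamma>))) \<le> D"
    and rect: "integral {-h..h} (\<lambda>\<xi>. integral {-\<gamma>..\<gamma>} (\<lambda>\<eta>. norm (strip_radon 1 f (\<xi>, \<eta>)))) \<le> D"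
    and x0: "\<bar>x\<^sub>0\<bar> \<le> 1"
  shows "norm (f (x\<^sub>0, \<gamma>)) \<le> 10000 * C * h powr \<alpha> + real n ^ (6 * n) * D"
proof -
  define v where "v = f (x\<^sub>0, \<gamma>)"
  define w where "w = poly (bump h n)"
  define Z where "Z = integral {-h..h} w"
  define I where "I = (\<lambda>x. integral {-h..h} (\<lambda>\<xi>. w \<xi> *\<^sub>R f (x, \<gamma> + \<xi> * x)))"
  define A where "A = (\<lambda>x. I x /\<^sub>R Z)"
  define Q where "Q = pcompose (jackson m) [:-x\<^sub>0 / 2, 1 / 2:]"
  define W where "W = (2 * real n) ^ n * (2 / h\<^sup>2) ^ n"
  have n: "8 \<le> n" using m by (simp add: n_def)
  have h: "0 < h" "h \<le> 1" using n by (auto simp: h_def divide_le_eq)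
  have Z: "h\<^sup>2 \<le> Z" "0 < Z"
    using bump_mass[of h n] n h by (auto simp: Z_def w_def h_def power2_eq_square elim: order.strict_trans2[rotated])
  have contw: "continuous_on X w" for X unfolding w_def by (intro continuous_intros)
  have contI: "continuous_on UNIV I"
  proof -
    have "continuous_on (UNIV \<times> cbox (-h) h) (\<lambda>(x, \<xi>). w \<xi> *\<^sub>R f (x, \<gamma> + \<xi> * x))"
      unfolding split_beta w_def
      by (intro continuous_intros continuous_on_compose2[OF cont]) auto
    from integral_continuous_on_param[OF this] show ?thesis by (simp add: I_def)
  qed
  have near: "norm (v - A x) \<le> 19 * C * h powr \<alpha> + (2 * C * h powr \<alpha> / h\<^sup>2) * (x - x\<^sub>0)\<^sup>2"
    if x: "\<bar>x\<bar> \<le> 3" for x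
    unfolding A_def I_def Z_def
  proof (rule weighted_average_near)
    show "continuous_on {-h..h} (\<lambda>\<xi>. f (x, \<gamma> + \<xi> * x))"
      by (intro continuous_on_compose2[OF cont] continuous_intros) auto
    fix \<xi> assume \<xi>: "\<xi> \<in> {-h..h}"
    then show "0 \<le> w \<xi>" unfolding w_def by (intro bump_nonneg) auto
    define d where "d = dist (x\<^sub>0, \<gamma>) (x, \<gamma> + \<xi> * x)"
    \<comment> \<open>Both displacements, \<open>x - x\<^sub>0\<close> and the height \<open>\<xi> x\<close> on the line, are compared with \<open>h\<close>; on the
        support of the stretched kernel \<open>\<bar>x\<bar> \<le> 3\<close>.\<close>
    have "\<bar>\<xi> * x\<bar> \<le> h * 3" using \<xi> x unfolding abs_mult by (intro mult_mono) auto
    moreover have "d \<le> \<bar>x - x\<^sub>0\<bar> + \<bar>\<xi> * x\<bar>"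
      using sqrt_sum_squares_le_sum_abs[of "dist x\<^sub>0 x" "dist \<gamma> (\<gamma> + \<xi> * x)"]
      by (simp add: d_def dist_Pair_Pair dist_real_def abs_minus_commute)
    ultimately have "d \<le> \<bar>x - x\<^sub>0\<bar> + 3 * h" by linarith
    then have "d / h \<le> \<bar>x - x\<^sub>0\<bar> / h + 3" using h by (simp add: field_simps)
    then have "(d / h)\<^sup>2 \<le> (\<bar>x - x\<^sub>0\<bar> / h + 3)\<^sup>2"
      using h by (intro power_mono) (auto simp: d_def)
    also have "\<dots> \<le> 2 * (\<bar>x - x\<^sub>0\<bar> / h)\<^sup>2 + 18"
    proof -
      have "(z + 3)\<^sup>2 \<le> 2 * z\<^sup>2 + 18" for z :: real
        using zero_le_power2[of "z - 3"] by (simp add: power2_eq_square algebra_simps)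
      then show ?thesis .
    qed
    finally have "1 + (d / h)\<^sup>2 \<le> 19 + 2 * (x - x\<^sub>0)\<^sup>2 / h\<^sup>2"
      by (simp add: power_divide)
    then have "C * (h powr \<alpha> * (1 + (d / h)\<^sup>2)) \<le> C * (h powr \<alpha> * (19 + 2 * (x - x\<^sub>0)\<^sup>2 / h\<^sup>2))"
      using C by (intro mult_left_mono) auto
    moreover have "norm (v - f (x, \<gamma> + \<xi> * x)) \<le> C * (h powr \<alpha> * (1 + (d / h)\<^sup>2))"
    proof -
      have "norm (v - f (x, \<gamma> + \<xi> * x)) \<le> C * d powr \<alpha>"
        unfolding v_def d_def by (rule hoelder)
      also have "\<dots> \<le> C * (h powr \<alpha> * (1 + (d / h)\<^sup>2))"
        using C h by (intro mult_left_mono powr_le_quadratic \<alpha>) (auto simp: d_def)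
      finally show ?thesis .
    qed
    ultimately show "norm (v - f (x, \<gamma> + \<xi> * x))
        \<le> 19 * C * h powr \<alpha> + (2 * C * h powr \<alpha> / h\<^sup>2) * (x - x\<^sub>0)\<^sup>2"
      by (simp add: algebra_simps)
  qed (use Z contw in \<open>auto simp: Z_def\<close>)
  have contA: "continuous_on UNIV A" unfolding A_def by (intro continuous_intros contI)
  have A0: "A x = 0" if "1 < \<bar>x\<bar>" for x
  proof -
    have "I x = integral {-h..h} (\<lambda>_. 0)"
      unfolding I_def by (intro integral_cong) (use outside[OF that] in auto)
    then show ?thesis by (simp add: A_def)
  qed
  have "0 \<le> 2 * C * h powr \<alpha> / h\<^sup>2" using C by simp
  from jackson_recovery[OF contA x0 A0 near this, of m]
  have "norm v \<le> 19 * C * h powr \<alpha> + 256 * (2 * C * h powr \<alpha> / h\<^sup>2) / (2 * real m + 1)\<^sup>2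
      + 4 * norm (integral {-1..1} (\<lambda>x. poly Q x *\<^sub>R A x))"
    by (simp only: Q_def)
  moreover have "256 * (2 * C * h powr \<alpha> / h\<^sup>2) / (2 * real m + 1)\<^sup>2 \<le> 8192 * C * h powr \<alpha>"
  proof -
    \<comment> \<open>The width \<open>1 / (2 m + 1)\<close> of the kernel is at most \<open>4 h\<close>, since \<open>n = 8 m\<close>.\<close>
    have "1 \<le> (4 * h * (2 * real m + 1))\<^sup>2"
      using m by (intro one_le_power) (simp add: h_def n_def field_simps)
    then have "C * h powr \<alpha> * 1 \<le> C * h powr \<alpha> * (16 * h\<^sup>2 * (2 * real m + 1)\<^sup>2)"
      using C by (intro mult_left_mono) (auto simp: power_mult_distrib)
    then show ?thesis
      using h by (simp add: field_simps)
  qed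
  moreover have "4 * norm (integral {-1..1} (\<lambda>x. poly Q x *\<^sub>R A x)) \<le> real n ^ (6 * n) * D"
  proof -
    have D: "0 \<le> D"
      by (rule order_trans[OF _ edge])
        (metis Henstock_Kurzweil_Integration.integral_nonneg norm_ge_zero not_integrable_integral order_refl)
    have "integral {-1..1} (\<lambda>x. poly Q x *\<^sub>R A x) = integral {-1..1} (\<lambda>x. poly Q x *\<^sub>R I x) /\<^sub>R Z"
      unfolding A_def by (simp only: scaleR_left_commute[of _ "inverse Z"] integral_cmul)
    then have "norm (integral {-1..1} (\<lambda>x. poly Q x *\<^sub>R A x))
        = norm (integral {-1..1} (\<lambda>x. poly Q x *\<^sub>R I x)) / Z"
      using Z by (simp add: divide_inverse)
    also have "norm (integral {-1..1} (\<lambda>x. poly Q x *\<^sub>R I x)) \<le> coeff_norm Q * (W * D)"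
      unfolding I_def w_def
    proof (rule polynomial_moment_le[OF cont below \<gamma> h(1) _ _ edge rect])
      show "degree Q \<le> n"
        unfolding Q_def n_def
        using degree_pcompose_le[of "jackson m" "[:-x\<^sub>0 / 2, 1 / 2:]"] degree_jackson[of m] by simp
      show "\<bar>poly ((pderiv ^^ k) (bump h n)) \<xi>\<bar> \<le> W" if "k \<le> n" "\<bar>\<xi>\<bar> \<le> h" for k \<xi>
        unfolding W_def using h that n by (intro higher_pderiv_bump_le) auto
    qed
    also have "coeff_norm Q * (W * D) \<le> (81 * 7 ^ n) * (W * D)"
    proof (rule mult_right_mono)
      have "coeff_norm Q \<le> coeff_norm (jackson m)"
        unfolding Q_def using x0 by (intro coeff_norm_pcompose) auto
      also have "\<dots> \<le> 81 * 7 ^ (4 * m)" by (rule coeff_norm_jackson)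
      also have "\<dots> \<le> 81 * 7 ^ n" by (simp add: n_def)
      finally show "coeff_norm Q \<le> 81 * 7 ^ n" .
    qed (use D in \<open>auto simp: W_def\<close>)
    finally have "4 * norm (integral {-1..1} (\<lambda>x. poly Q x *\<^sub>R A x)) \<le> 324 * 7 ^ n * (W * D) / Z"
      using Z by (simp add: divide_right_mono)
    also have "\<dots> \<le> 324 * 7 ^ n * (W * D) / h\<^sup>2"
      using Z h D by (intro divide_left_mono) (auto simp: W_def)
    also have "\<dots> = (324 * 7 ^ n * (2 * real n) ^ n * (2 * (real n)\<^sup>2) ^ n * (real n)\<^sup>2) * D"
      by (simp add: W_def h_def power_divide)
    also have "\<dots> \<le> real n ^ (6 * n) * D"
      using amplification_le[OF n] D by (intro mult_right_mono) auto
    finally show ?thesis .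
  qed
  moreover have "0 \<le> C * h powr \<alpha>" using C by simp
  ultimately show ?thesis unfolding v_def by linarith
qed

section \<open>Hoelder functions and their Radon transforms\<close>

lemma hoelder_seminorm_leD:
  assumes "hoelder_seminorm \<alpha> f \<le> ennreal C" "0 \<le> C"
  shows "norm (f p - f q) \<le> C * dist p q powr \<alpha>"
proof (cases "p = q")
  case False
  have "ennreal (norm (f p - f q) / dist p q powr \<alpha>) \<le> hoelder_seminorm \<alpha> f"
    unfolding hoelder_seminorm_def by (rule SUP_upper2[of "(p, q)"]) (use False in auto)
  with assms have "norm (f p - f q) / dist p q powr \<alpha> \<le> C"
    by (meson ennreal_le_iff order_trans)
  then show ?thesis using False by (simp add: divide_le_eq)
qed simp

lemma hoelder_continuous:
  fixes f :: "real \<times> real \<Rightarrow> complex"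
  assumes "\<And>p q. norm (f p - f q) \<le> C * dist p q powr \<alpha>" "0 < \<alpha>"
  shows "continuous_on UNIV f"
proof (rule continuous_at_imp_continuous_on, intro ballI)
  fix p :: "real \<times> real"
  have dist: "((\<lambda>q. dist q p) \<longlongrightarrow> 0) (at p)"
    by (rule tendsto_dist_iff[THEN iffD1, OF tendsto_ident_at])
  have "((\<lambda>q. dist q p powr \<alpha>) \<longlongrightarrow> 0) (at p)"
    by (rule tendsto_zero_powrI[OF dist tendsto_const _ assms(2)]) simp
  then have bound: "((\<lambda>q. C * dist q p powr \<alpha>) \<longlongrightarrow> 0) (at p)"
    by (rule tendsto_mult_right_zero)
  have "((\<lambda>q. f q - f p) \<longlongrightarrow> 0) (at p)"
    by (rule Lim_null_comparison[OF _ bound]) (simp add: assms(1))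
  then show "isCont f p"
    by (simp add: isCont_def LIM_zero_iff)
qed

lemma eq_0_below_parabola:
  assumes "supp f \<subseteq> {(x, y). x\<^sup>2 \<le> y}" "y < x\<^sup>2"
  shows "f (x, y) = 0"
  using assms closure_subset[of "{p. f p \<noteq> 0}"] unfolding supp_def by fastforce

lemma radon_eq_strip_radon:
  assumes cont: "continuous_on UNIV f"
    and zero: "\<And>x. B < \<bar>x\<bar> \<Longrightarrow> f (x, \<eta> + \<xi> * x) = 0"
  shows "radon f (\<xi>, \<eta>) = strip_radon B f (\<xi>, \<eta>)"
proof -
  have "continuous_on {-B..B} (\<lambda>x. f (x, \<xi> * x + \<eta>))"
    by (intro continuous_on_compose2[OF cont] continuous_intros) auto
  from set_borel_integral_eq_integral(2)[OF borel_integrable_atLeastAtMost'[OF this]]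
  have "(LINT x:{-B..B}|lborel. f (x, \<xi> * x + \<eta>)) = strip_radon B f (\<xi>, \<eta>)"
    by (simp add: strip_radon_def)
  moreover have "indicator {-B..B} x *\<^sub>R f (x, \<xi> * x + \<eta>) = f (x, \<xi> * x + \<eta>)" for x
    using zero[of x] by (auto simp: indicator_def add.commute)
  ultimately show ?thesis by (simp add: radon_def set_lebesgue_integral_def)
qed

text \<open>
  The lower bound for the data norm is available for continuous data only. On the closed rectangle all
  lines have slope at most \<open>\<epsilon>\<close> and meet the epigraph of the parabola only for \<open>\<bar>x\<bar> \<le> \<epsilon> + 1\<close>, so that
  the transform is an integral over a fixed compact interval.
\<close>

lemma continuous_on_radon:
  assumes cont: "continuous_on UNIV f"
    and zero: "\<And>x y. y < x\<^sup>2 \<Longrightarrow> f (x, y) = 0"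
    and \<epsilon>: "0 < \<epsilon>" and \<gamma>: "0 < \<gamma>" "\<gamma> \<le> 1"
  shows "continuous_on (closure (data_rect \<epsilon> \<gamma>)) (radon f)"
proof -
  have closed: "closed {p :: real \<times> real. \<bar>fst p\<bar> \<le> \<epsilon> \<and> \<bar>snd p\<bar> \<le> \<gamma>}"
    by (intro closed_Collect_conj closed_Collect_le continuous_intros)
  have "closure (data_rect \<epsilon> \<gamma>) \<subseteq> {p. \<bar>fst p\<bar> \<le> \<epsilon> \<and> \<bar>snd p\<bar> \<le> \<gamma>}"
    by (rule closure_minimal[OF _ closed]) (auto simp: data_rect_def)
  then have eq: "strip_radon (\<epsilon> + 1) f p = radon f p" if "p \<in> closure (data_rect \<epsilon> \<gamma>)" for p
    using that \<epsilon> \<gamma>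
    by (cases p) (auto intro!: radon_eq_strip_radon[symmetric] cont
        parabola_line_zero[where f = f, OF zero, where h = \<epsilon> and \<gamma> = \<gamma>])
  have "continuous_on (closure (data_rect \<epsilon> \<gamma>)) (strip_radon (\<epsilon> + 1) f)"
    by (rule continuous_on_subset[OF continuous_on_strip_radon[OF cont]]) simp
  then show ?thesis by (rule continuous_on_eq) (rule eq)
qed

text \<open>
  The moment estimates take primitives of the data along the whole half-line \<open>\<eta> \<le> \<gamma>\<close>, beyond the
  rectangle. The data are therefore represented by a globally continuous function \<open>G\<close> that has the same
  values on these half-lines.
\<close>

lemma data_norm_family_bounds:
  fixes g G :: "real \<times> real \<Rightarrow> complex"
  assumes N: "data_norm_family c N" and c: "0 < c"
    and \<epsilon>: "0 < \<epsilon>" and \<gamma>: "0 < \<gamma>" "\<gamma> \<le> 1" and h: "h \<le> \<epsilon>"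
    and g: "continuous_on (closure (data_rect \<epsilon> \<gamma>)) g"
    and G: "continuous_on UNIV G" "\<And>\<xi> \<eta>. \<bar>\<xi>\<bar> \<le> h \<Longrightarrow> \<eta> \<le> \<gamma> \<Longrightarrow> g (\<xi>, \<eta>) = G (\<xi>, \<eta>)"
    and t: "N \<epsilon> \<gamma> g \<le> ennreal t" "0 \<le> t"
  shows "integral {-h..h} (\<lambda>\<xi>. norm (G (\<xi>, \<gamma>))) \<le> t / c"
    and "integral {-h..h} (\<lambda>\<xi>. integral {-\<gamma>..\<gamma>} (\<lambda>\<eta>. norm (G (\<xi>, \<eta>)))) \<le> t / c"
proof -
  define E where "E = (\<integral>\<^sup>+\<xi>\<in>{-\<epsilon>..\<epsilon>}. ennreal (norm (g (\<xi>, \<gamma>))) \<partial>lborel)"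
  define R where "R = (\<integral>\<^sup>+p\<in>data_rect \<epsilon> \<gamma>. ennreal (norm (g p)) \<partial>lborel)"
  have "ennreal c * max R E \<le> N \<epsilon> \<gamma> g"
    unfolding R_def E_def
    by (rule N[unfolded data_norm_family_def, THEN conjunct2, THEN conjunct2, rule_format, OF \<epsilon> \<gamma> g])
  with t(1) have max: "ennreal c * max R E \<le> ennreal t" by (rule order_trans[rotated])
  have le: "r \<le> t / c" if "ennreal r \<le> max R E" "0 \<le> r" for r
  proof -
    have "ennreal (c * r) \<le> ennreal c * max R E"
      using that c by (simp add: ennreal_mult mult_left_mono)
    also note max
    finally have "ennreal (c * r) \<le> ennreal t" .
    then show ?thesis using t c by (simp add: field_simps)
  qed
  have contG: "continuous_on X (\<lambda>\<xi>. norm (G (\<xi>, \<gamma>)))" for X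
    by (intro continuous_intros continuous_on_compose2[OF G(1)]) auto
  show "integral {-h..h} (\<lambda>\<xi>. norm (G (\<xi>, \<gamma>))) \<le> t / c"
  proof (rule le)
    have "ennreal (integral {-h..h} (\<lambda>\<xi>. norm (G (\<xi>, \<gamma>))))
        = (\<integral>\<^sup>+\<xi>\<in>{-h..h}. ennreal (norm (G (\<xi>, \<gamma>))) \<partial>lborel)"
      by (intro nn_integral_has_integral_lebesgue'[symmetric] integrable_integral
          integrable_continuous_real contG) auto
    also have "\<dots> \<le> E"
      unfolding E_def using h
      by (intro nn_integral_mono) (auto simp: indicator_def G(2)[symmetric])
    finally show "ennreal (integral {-h..h} (\<lambda>\<xi>. norm (G (\<xi>, \<gamma>)))) \<le> max R E"
      by (simp add: le_max_iff_disj)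
  qed (simp add: integral_nonneg integrable_continuous_real contG)
  have contG2: "continuous_on X (\<lambda>p. norm (G p))" for X
    by (intro continuous_intros continuous_on_subset[OF G(1)]) auto
  have fubini: "integral (cbox (-h, -\<gamma>) (h, \<gamma>)) (\<lambda>p. norm (G p))
      = integral {-h..h} (\<lambda>\<xi>. integral {-\<gamma>..\<gamma>} (\<lambda>\<eta>. norm (G (\<xi>, \<eta>))))"
    using integral_prod_continuous[OF contG2, of "-h" "-\<gamma>" h \<gamma>] by simp
  show "integral {-h..h} (\<lambda>\<xi>. integral {-\<gamma>..\<gamma>} (\<lambda>\<eta>. norm (G (\<xi>, \<eta>)))) \<le> t / c"
    unfolding fubini[symmetric]
  proof (rule le)
    \<comment> \<open>The open box has the same integral and, unlike the closed one, lies in the rectangle, whose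
        condition \<open>\<bar>\<eta>\<bar> < \<gamma>\<close> is strict.\<close>
    have "((\<lambda>p. norm (G p)) has_integral integral (cbox (-h, -\<gamma>) (h, \<gamma>)) (\<lambda>p. norm (G p))) (box (-h, -\<gamma>) (h, \<gamma>))"
      unfolding has_integral_open_interval by (intro integrable_integral integrable_continuous contG2)
    then have "ennreal (integral (cbox (-h, -\<gamma>) (h, \<gamma>)) (\<lambda>p. norm (G p)))
        = (\<integral>\<^sup>+p\<in>box (-h, -\<gamma>) (h, \<gamma>). ennreal (norm (G p)) \<partial>lborel)"
      by (intro nn_integral_has_integral_lebesgue'[symmetric]) auto
    also have "\<dots> \<le> R"
      unfolding R_def
    proof (intro nn_integral_mono)
      fix p :: "real \<times> real"
      obtain \<xi> \<eta> where p: "p = (\<xi>, \<eta>)" by force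
      show "ennreal (norm (G p)) * indicator (box (-h, -\<gamma>) (h, \<gamma>)) p
          \<le> ennreal (norm (g p)) * indicator (data_rect \<epsilon> \<gamma>) p"
        using h G(2)[of \<xi> \<eta>]
        by (auto simp: p indicator_def data_rect_def mem_box Basis_prod_def)
    qed
    finally show "ennreal (integral (cbox (-h, -\<gamma>) (h, \<gamma>)) (\<lambda>p. norm (G p))) \<le> max R E"
      by (simp add: le_max_iff_disj)
  qed (intro integral_nonneg integrable_continuous contG2, simp)
qed

section \<open>The choice of scale\<close>

text \<open>
  With \<open>L = log (1 / t)\<close> the scale \<open>n\<close> is chosen of order \<open>L / log L\<close>. The amplification is then
  \<open>n\<^sup>6\<^sup>n \<le> exp (L / 2) = t\<^sup>-\<^sup>1\<^sup>/\<^sup>2\<close>, so that the amplified data are negligible against the approximation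
  error \<open>n\<^sup>-\<^sup>\<alpha>\<close>, which is of order \<open>(log L / L)\<^sup>\<alpha>\<close>. The denominator \<open>96 log L\<close> makes
  \<open>6 n log n \<le> L / 2\<close> for \<open>n = 8 m\<close>.
\<close>

lemma scale_choice:
  fixes \<alpha> \<rho> :: real
  assumes \<alpha>: "0 < \<alpha>" "\<alpha> \<le> 1"
  shows "\<exists>\<delta>>0. \<forall>t. 0 < t \<longrightarrow> t < \<delta> \<longrightarrow> (\<exists>m\<ge>1. \<rho> \<le> real (8 * m) \<and>
     (1 / real (8 * m)) powr \<alpha> \<le> 24 * log_rate \<alpha> t \<and>
     real (8 * m) ^ (6 * (8 * m)) * t \<le> 48 * log_rate \<alpha> t)"
proof -
  have "eventually (\<lambda>L::real. 1 \<le> L / (96 * ln L) \<and> \<rho> \<le> L / (96 * ln L) \<and> 1 \<le> ln L \<and> 1 \<le> L) at_top"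
    by (intro eventually_conj; real_asymp)
  then obtain L\<^sub>0 where L0: "\<And>L. L\<^sub>0 \<le> L \<Longrightarrow> 1 \<le> L / (96 * ln L) \<and> \<rho> \<le> L / (96 * ln L) \<and> 1 \<le> ln L \<and> 1 \<le> L"
    by (auto simp: eventually_at_top_linorder)
  show ?thesis
  proof (intro exI[of _ "exp (-L\<^sub>0)"] conjI allI impI)
    fix t :: real assume t: "0 < t" "t < exp (-L\<^sub>0)"
    define L where "L = ln (inverse t)"
    define l where "l = ln L"
    define z where "z = L / (96 * l)"
    define m where "m = nat \<lfloor>z\<rfloor>"
    define n where "n = 8 * m"
    have "ln t < -L\<^sub>0" using t by (metis ln_exp ln_less_cancel_iff exp_gt_zero)
    then have "L\<^sub>0 \<le> L" using t by (simp add: L_def ln_inverse)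
    from L0[OF this] have z: "1 \<le> z" "\<rho> \<le> z" and l: "1 \<le> l" and L: "1 \<le> L"
      by (auto simp: z_def l_def)
    have texp: "t = exp (-L)" using t by (simp add: L_def ln_inverse)
    have m: "1 \<le> m" using z by (simp add: m_def le_nat_iff le_floor_iff)
    have mz: "real m \<le> z" "z < real m + 1" using z by (auto simp: m_def of_nat_nat)
    then have zm: "z \<le> 2 * real m" using m by linarith
    have n: "8 \<le> n" using m by (simp add: n_def)
    have n_le: "real n \<le> L / (12 * l)" using mz l by (simp add: n_def z_def field_simps)
    have "L / (12 * l) \<le> L / 1" using L l by (intro divide_left_mono) auto
    with n_le have nL: "real n \<le> L" by simp
    have "4 * z \<le> real n" using zm by (simp add: n_def)
    then have n_ge: "1 / real n \<le> 24 * (l / L)"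
      using l L n z by (simp add: z_def field_simps)
    have rate: "log_rate \<alpha> t = (l / L) powr \<alpha>"
      using t l L by (simp add: log_rate_def L_def[symmetric] l_def[symmetric] powr_divide)
    have "(1 / real n) powr \<alpha> \<le> (24 * (l / L)) powr \<alpha>"
      using n_ge \<alpha> by (intro powr_mono2) auto
    also have "\<dots> = 24 powr \<alpha> * (l / L) powr \<alpha>"
      by (rule powr_mult)
    also have "\<dots> \<le> 24 powr 1 * (l / L) powr \<alpha>"
      using \<alpha> by (intro mult_right_mono powr_mono) auto
    finally have first: "(1 / real n) powr \<alpha> \<le> 24 * log_rate \<alpha> t" by (simp add: rate)
    have "real (6 * n) * ln (real n) \<le> (6 * (L / (12 * l))) * l"
      using n_le nL n L l by (intro mult_mono) (auto simp: l_def)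
    also have "\<dots> = L / 2" using l by (simp add: field_simps)
    finally have "exp (real (6 * n) * ln (real n)) \<le> exp (L / 2)" by (simp only: exp_le_cancel_iff)
    moreover have "exp (real (6 * n) * ln (real n)) = real n ^ (6 * n)"
      using n by (subst exp_of_nat_mult) simp
    ultimately have "real n ^ (6 * n) \<le> exp (L / 2)" by (simp only:)
    then have "real n ^ (6 * n) * t \<le> exp (L / 2) * exp (-L)"
      unfolding texp by (rule mult_right_mono) simp
    also have "\<dots> = 1 / exp (L / 2)" by (simp add: exp_minus field_simps flip: exp_add)
    also have "\<dots> \<le> 1 / (L / 2)"
    proof (rule divide_left_mono)
      show "L / 2 \<le> exp (L / 2)" using exp_ge_add_one_self[of "L / 2"] by linarith
    qed (use L in simp_all)
    also have "\<dots> = 2 * (1 / L)" by simp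
    also have "\<dots> \<le> 2 * (1 / real n) powr 1"
      using nL n by (auto intro!: divide_left_mono)
    also have "\<dots> \<le> 2 * (1 / real n) powr \<alpha>"
      using \<alpha> n by (intro mult_left_mono powr_mono') auto
    finally have "real n ^ (6 * n) * t \<le> 48 * log_rate \<alpha> t" using first by linarith
    with first m z \<open>4 * z \<le> real n\<close>
    show "\<exists>m\<ge>1. \<rho> \<le> real (8 * m) \<and> (1 / real (8 * m)) powr \<alpha> \<le> 24 * log_rate \<alpha> t \<and>
       real (8 * m) ^ (6 * (8 * m)) * t \<le> 48 * log_rate \<alpha> t"
      unfolding n_def by (intro exI[of _ m]) auto
  qed simp
qed

section \<open>Stability of the slice\<close>

lemma L2_norm_le:
  assumes "continuous_on {-1..1} \<phi>" "\<And>x. \<bar>x\<bar> \<le> 1 \<Longrightarrow> norm (\<phi> x) \<le> E"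
  shows "L2_norm \<phi> \<le> 2 * E"
proof -
  have E: "0 \<le> E" using assms(2)[of 0] norm_ge_zero[of "\<phi> 0"] by linarith
  have cont: "continuous_on {-1..1} (\<lambda>x. (norm (\<phi> x))\<^sup>2)"
    by (intro continuous_intros assms(1))
  have "(LINT x:{-1..1}|lborel. (norm (\<phi> x))\<^sup>2) = integral {-1..1} (\<lambda>x. (norm (\<phi> x))\<^sup>2)"
    by (rule set_borel_integral_eq_integral(2)[OF borel_integrable_atLeastAtMost'[OF cont]])
  also have "\<dots> \<le> integral {-1..1::real} (\<lambda>_. E\<^sup>2)"
    using cont assms(2) by (intro integral_le integrable_continuous_real power_mono) auto
  also have "\<dots> \<le> (2 * E)\<^sup>2" by (simp add: power2_eq_square)
  finally show ?thesis
    unfolding L2_norm_def using E by (intro real_le_lsqrt) auto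
qed

text \<open>
  The bounds \<open>\<gamma> \<le> 1/2\<close> and \<open>h \<le> \<gamma> / 2\<close> confine the lines in question, over \<open>\<bar>x\<bar> \<le> 1\<close>, to heights
  below \<open>1\<close>, where the windowed primitives are true primitives. They also make the data vanish for
  \<open>\<eta> \<le> -\<gamma>\<close>, so that integration from below starts inside the rectangle.
\<close>

lemma slice_stability_at_scale:
  assumes N: "data_norm_family c N" "0 < c"
    and \<alpha>: "0 < \<alpha>" "\<alpha> \<le> 1" and C: "0 \<le> C"
    and \<gamma>: "0 < \<gamma>" "\<gamma> \<le> 1 / 2" and \<epsilon>: "0 < \<epsilon>"
    and f: "hoelder_seminorm \<alpha> f \<le> ennreal C" "supp f \<subseteq> {(x, y). x\<^sup>2 \<le> y}"
    and t: "N \<epsilon> \<gamma> (radon f) \<le> ennreal t" "0 \<le> t"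
    and m: "1 \<le> m" and n: "max (2 / \<gamma>) (1 / \<epsilon>) \<le> real (8 * m)"
  shows "L2_norm (\<lambda>x. f (x, \<gamma>))
    \<le> 2 * (10000 * C * (1 / real (8 * m)) powr \<alpha> + real (8 * m) ^ (6 * (8 * m)) * (t / c))"
proof -
  define h where "h = 1 / real (8 * m)"
  have h: "0 < h" "h \<le> \<epsilon>" "h \<le> \<gamma> / 2"
    using m n \<epsilon> \<gamma> by (auto simp: h_def field_simps)
  note hoelder = hoelder_seminorm_leD[OF f(1) C]
  note cont = hoelder_continuous[OF hoelder \<alpha>(1)]
  note zero = eq_0_below_parabola[OF f(2)]
  have below: "f (x, y) = 0" if "y < 0" for x y
    using that by (intro zero) (simp add: less_le_trans)
  have line: "f (x, \<eta> + \<xi> * x) = 0" if "1 < \<bar>x\<bar>" "\<bar>\<xi>\<bar> \<le> h" "\<eta> \<le> \<gamma>" for x \<xi> \<eta>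
    using that h \<gamma> by (intro parabola_line_zero[where f = f, OF zero, where h = h and \<gamma> = \<gamma>]) auto
  have eq: "radon f (\<xi>, \<eta>) = strip_radon 1 f (\<xi>, \<eta>)" if "\<bar>\<xi>\<bar> \<le> h" "\<eta> \<le> \<gamma>" for \<xi> \<eta>
    using that line by (intro radon_eq_strip_radon cont) auto
  have "\<gamma> \<le> 1" using \<gamma> by simp
  note bounds = data_norm_family_bounds[OF N \<epsilon> \<gamma>(1) \<open>\<gamma> \<le> 1\<close> h(2)
      continuous_on_radon[OF cont zero \<epsilon> \<gamma>(1) \<open>\<gamma> \<le> 1\<close>] continuous_on_strip_radon[OF cont] eq t]
  show ?thesis
  proof (rule L2_norm_le)
    show "continuous_on {-1..1} (\<lambda>x. f (x, \<gamma>))"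
      by (intro continuous_on_compose2[OF cont] continuous_intros) auto
    show "norm (f (x, \<gamma>)) \<le> 10000 * C * (1 / real (8 * m)) powr \<alpha> + real (8 * m) ^ (6 * (8 * m)) * (t / c)"
      if "\<bar>x\<bar> \<le> 1" for x
      unfolding h_def[symmetric]
    proof (rule slice_value_le[OF hoelder cont \<alpha> C below _ m refl h_def _ _ bounds that])
      show "f (x, \<gamma> + \<xi> * x) = 0" if "1 < \<bar>x\<bar>" "\<bar>\<xi>\<bar> \<le> h" for x \<xi>
        using that by (rule line) simp
    qed (use h \<gamma> in simp_all)
  qed
qed

theorem theorem3p7:
  "\<exists>\<gamma>\<^sub>0>0. \<exists>K>0. \<forall>c N. 0 < c \<longrightarrow> data_norm_family c N \<longrightarrow>
     (\<forall>\<alpha> C\<^sub>0 \<gamma> \<epsilon> :: real. 0 < \<alpha> \<longrightarrow> \<alpha> \<le> 1 \<longrightarrow> 0 < C\<^sub>0 \<longrightarrow> 0 < \<gamma> \<longrightarrow> \<gamma> \<le> \<gamma>\<^sub>0 \<longrightarrow> 0 < \<epsilon> \<longrightarrow>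
       (\<exists>M>0. \<exists>\<delta>>0. \<forall>f :: real \<times> real \<Rightarrow> complex.
          hoelder_seminorm \<alpha> f \<le> ennreal C\<^sub>0 \<longrightarrow>
          supp f \<subseteq> {(x, y). x\<^sup>2 \<le> y} \<longrightarrow>
          N \<epsilon> \<gamma> (radon f) < ennreal \<delta> \<longrightarrow>
          L2_norm (\<lambda>x. f (x, \<gamma>)) \<le> K * (M * log_rate \<alpha> (enn2real (N \<epsilon> \<gamma> (radon f))))))"
proof (rule exI[of _ "1 / 2"], intro conjI, simp, rule exI[of _ 1], intro conjI allI impI, simp)
  fix c N and \<alpha> C \<gamma> \<epsilon> :: real
  assume c: "0 < c" and N: "data_norm_family c N" and \<alpha>: "0 < \<alpha>" "\<alpha> \<le> 1" and C: "0 < C"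
    and \<gamma>: "0 < \<gamma>" "\<gamma> \<le> 1 / 2" and \<epsilon>: "0 < \<epsilon>"
  define \<rho> where "\<rho> = max (2 / \<gamma>) (1 / \<epsilon>)"
  define M where "M = 2 * (240000 * C + 48 / c)"
  obtain \<delta> where \<delta>: "0 < \<delta>"
    and scale: "\<And>t. 0 < t \<Longrightarrow> t < \<delta> \<Longrightarrow> \<exists>m\<ge>1. \<rho> \<le> real (8 * m) \<and>
      (1 / real (8 * m)) powr \<alpha> \<le> 24 * log_rate \<alpha> t \<and>
      real (8 * m) ^ (6 * (8 * m)) * t \<le> 48 * log_rate \<alpha> t"
    using scale_choice[OF \<alpha>, of \<rho>] by blast
  have "L2_norm (\<lambda>x. f (x, \<gamma>)) \<le> 1 * (M * log_rate \<alpha> (enn2real (N \<epsilon> \<gamma> (radon f))))"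
    if f: "hoelder_seminorm \<alpha> f \<le> ennreal C" "supp f \<subseteq> {(x, y). x\<^sup>2 \<le> y}"
      and small: "N \<epsilon> \<gamma> (radon f) < ennreal \<delta>" for f :: "real \<times> real \<Rightarrow> complex"
  proof -
    define t where "t = enn2real (N \<epsilon> \<gamma> (radon f))"
    have Nt: "N \<epsilon> \<gamma> (radon f) = ennreal t"
      unfolding t_def using less_trans[OF small ennreal_less_top] by (simp add: ennreal_enn2real)
    have t: "0 \<le> t" "t < \<delta>" using small \<delta> unfolding Nt by (auto simp: t_def ennreal_less_iff)
    have bound: "L2_norm (\<lambda>x. f (x, \<gamma>))
        \<le> 2 * (10000 * C * (1 / real (8 * m)) powr \<alpha> + real (8 * m) ^ (6 * (8 * m)) * (t / c))"
      if "1 \<le> m" "\<rho> \<le> real (8 * m)" for m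
      using slice_stability_at_scale[OF N c \<alpha> _ \<gamma> \<epsilon> f _ t(1), of m] that C Nt by (simp add: \<rho>_def)
    show ?thesis
    proof (cases "t = 0")
      case True
      \<comment> \<open>For vanishing data the estimate holds at every large scale, so the slice vanishes.\<close>
      have "((\<lambda>m. 2 * (10000 * C * (1 / real (8 * m)) powr \<alpha>)) \<longlongrightarrow> 2 * (10000 * C * 0)) at_top"
        using \<alpha>(1) by (intro tendsto_intros tendsto_zero_powrI) (auto, real_asymp)
      moreover have "\<forall>\<^sub>F m in at_top. L2_norm (\<lambda>x. f (x, \<gamma>)) \<le> 2 * (10000 * C * (1 / real (8 * m)) powr \<alpha>)"
      proof -
        have "\<forall>\<^sub>F m in at_top. \<rho> \<le> real (8 * m)" by real_asymp
        then show ?thesis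
          using eventually_ge_at_top[of 1] by eventually_elim (use bound True in simp)
      qed
      ultimately have "L2_norm (\<lambda>x. f (x, \<gamma>)) \<le> 2 * (10000 * C * 0)"
        by (intro tendsto_lowerbound) auto
      then show ?thesis using True by (simp add: t_def[symmetric] log_rate_def)
    next
      case False
      then obtain m where m: "1 \<le> m" "\<rho> \<le> real (8 * m)"
        and rate: "(1 / real (8 * m)) powr \<alpha> \<le> 24 * log_rate \<alpha> t"
          "real (8 * m) ^ (6 * (8 * m)) * t \<le> 48 * log_rate \<alpha> t"
        using scale[of t] t by auto
      have "10000 * C * (1 / real (8 * m)) powr \<alpha> \<le> 10000 * C * (24 * log_rate \<alpha> t)"
        using C rate(1) by (intro mult_left_mono) auto
      moreover have "real (8 * m) ^ (6 * (8 * m)) * (t / c) \<le> 48 * log_rate \<alpha> t / c"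
        using c divide_right_mono[OF rate(2), of c] by simp
      ultimately show ?thesis
        using bound[OF m] unfolding t_def[symmetric] M_def
        by (auto simp: distrib_left distrib_right)
    qed
  qed
  moreover have "0 < M" using C c by (simp add: M_def add_pos_pos)
  ultimately show "\<exists>M>0. \<exists>\<delta>>0. \<forall>f :: real \<times> real \<Rightarrow> complex.
      hoelder_seminorm \<alpha> f \<le> ennreal C \<longrightarrow> supp f \<subseteq> {(x, y). x\<^sup>2 \<le> y} \<longrightarrow>
      N \<epsilon> \<gamma> (radon f) < ennreal \<delta> \<longrightarrow>
      L2_norm (\<lambda>x. f (x, \<gamma>)) \<le> 1 * (M * log_rate \<alpha> (enn2real (N \<epsilon> \<gamma> (radon f))))"
    using \<delta> by blast
qed

end
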